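(* Let $\Gamma$ be a simplicial graph and $\mathcal{G}$ a collection of groups indexed by $V(\Gamma)$. The small crossing graph $\mathrm{ST}(\Gamma,\mathcal{G})$ coincides with the graph whose vertices are the hyperplanes of $\mathrm{QM}(\Gamma,\mathcal{G})$ labelled by $\prec$-maximal vertices of $\Gamma$ and whose edges link two hyperplanes whenever they are transverse: the map sending a hyperplane $gJ_u$ (with $g\in\Gamma\mathcal{G}$ and $u$ a $\prec$-maximal vertex) to the subgroup $gG_ug^{-1}$ is a well-defined isomorphism between these graphs.
   Context: Given a simplicial graph $\Gamma$ and a collection of groups $\mathcal{G}=\{G_u\mid u\in V(\Gamma)\}$, the graph product $\Gamma\mathcal{G}$ is the quotient of the free product of the $G_u$ by the normal closure of all commutators $[g,h]$ with $g\in G_u$, $h\in G_v$, $\{u,v\}\in E(\Gamma)$. The vertex-groups $G_u$ are always assumed non-trivial. $\mathrm{link}(u)$ is the subgraph induced by the neighbors of $u$, $\mathrm{star}(u)$ the subgraph induced by $\mathrm{link}(u)\cup\{u\}$; $u\prec v$ means $\mathrm{link}(u)\subset\mathrm{star}(v)$, and $u$ is $\prec$-maximal if $u\prec v$ implies $v\prec u$ for every vertex $v$. The small crossing graph $\mathrm{ST}(\Gamma,\mathcal{G})$ is the graph whose vertices are the conjugates in $\Gamma\mathcal{G}$ of the vertex-groups indexed by $\prec$-maximal vertices of $\Gamma$ and whose edges link two distinct subgroups if they commute. $\mathrm{QM}(\Gamma,\mathcal{G})$ is the Cayley graph of $\Gamma\mathcal{G}$ with respect to the generating set $\bigcup_{u\in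 V(\Gamma)}G_u\setminus\{1\}$, on which $\Gamma\mathcal{G}$ acts by left multiplication. A hyperplane of $\mathrm{QM}(\Gamma,\mathcal{G})$ is an equivalence class of edges for the transitive closure of the relation identifying two edges which are opposite in a square (an induced 4-cycle) or which belong to a common triangle. For $u\in V(\Gamma)$, $J_u$ is the hyperplane containing all the edges of the complete subgraph $G_u$; every hyperplane is of the form $gJ_u$ for some $g\in\Gamma\mathcal{G}$ and a unique $u\in V(\Gamma)$, and it is then said to be labelled by $u$. Two hyperplanes are transverse if they intersect a common square along its two distinct pairs of opposite edges. *)

theory Defs
  imports "HOL-Algebra.Coset"
begin

section \<open>Graphs\<close>

record 'v ugraph =
  verts :: "'v set"
  edges :: "'v set set"

text \<open>Simplicial: no loops and no multiple edges; the graph may be infinite.\<close>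

definition simplicial_graph :: "'v ugraph \<Rightarrow> bool" where
  "simplicial_graph X \<longleftrightarrow>
     (\<forall>e\<in>edges X. \<exists>u\<in>verts X. \<exists>v\<in>verts X. u \<noteq> v \<and> e = {u, v})"

definition induced_subgraph :: "'v ugraph \<Rightarrow> 'v set \<Rightarrow> 'v ugraph" where
  "induced_subgraph X S =
     \<lparr>verts = verts X \<inter> S, edges = {e \<in> edges X. e \<subseteq> S}\<rparr>"

definition subgraph :: "'v ugraph \<Rightarrow> 'v ugraph \<Rightarrow> bool" where
  "subgraph X Y \<longleftrightarrow> verts X \<subseteq> verts Y \<and> edges X \<subseteq> edges Y"

definition neighbors :: "'v ugraph \<Rightarrow> 'v \<Rightarrow> 'v set" where
  "neighbors X u = {v \<in> verts X. {u, v} \<in> edges X}"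

definition link :: "'v ugraph \<Rightarrow> 'v \<Rightarrow> 'v ugraph" where
  "link X u = induced_subgraph X (neighbors X u)"

definition star :: "'v ugraph \<Rightarrow> 'v \<Rightarrow> 'v ugraph" where
  "star X u = induced_subgraph X (insert u (neighbors X u))"

definition prec :: "'v ugraph \<Rightarrow> 'v \<Rightarrow> 'v \<Rightarrow> bool" where
  "prec X u v \<longleftrightarrow> subgraph (link X u) (star X v)"

definition prec_maximal :: "'v ugraph \<Rightarrow> 'v \<Rightarrow> bool" where
  "prec_maximal X u \<longleftrightarrow>
     u \<in> verts X \<and> (\<forall>v\<in>verts X. prec X u v \<longrightarrow> prec X v u)"

text \<open>The vertices x and y need not be distinct below, so an isomorphism also preserves the
  absence of loops.\<close>

definition graph_isomorphism :: "('v \<Rightarrow> 'w) \<Rightarrow> 'v ugraph \<Rightarrow> 'w ugraph \<Rightarrow> bool" where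
  "graph_isomorphism \<phi> X Y \<longleftrightarrow>
     bij_betw \<phi> (verts X) (verts Y) \<and>
     (\<forall>x\<in>verts X. \<forall>y\<in>verts X. {x, y} \<in> edges X \<longleftrightarrow> {\<phi> x, \<phi> y} \<in> edges Y)"


section \<open>Hyperplanes\<close>

text \<open>An induced 4-cycle with cyclically ordered vertices a, b, c, d.\<close>

definition is_square :: "'v ugraph \<Rightarrow> 'v \<Rightarrow> 'v \<Rightarrow> 'v \<Rightarrow> 'v \<Rightarrow> bool" where
  "is_square X a b c d \<longleftrightarrow>
     distinct [a, b, c, d] \<and>
     {a, b} \<in> edges X \<and> {b, c} \<in> edges X \<and> {c, d} \<in> edges X \<and> {d, a} \<in> edges X \<and>
     {a, c} \<notin> edges X \<and> {b, d} \<notin> edges X"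

definition is_triangle :: "'v ugraph \<Rightarrow> 'v \<Rightarrow> 'v \<Rightarrow> 'v \<Rightarrow> bool" where
  "is_triangle X a b c \<longleftrightarrow>
     distinct [a, b, c] \<and> {a, b} \<in> edges X \<and> {b, c} \<in> edges X \<and> {a, c} \<in> edges X"

definition elementary_parallel :: "'v ugraph \<Rightarrow> ('v set \<times> 'v set) set" where
  "elementary_parallel X =
     {({a, b}, {c, d}) | a b c d. is_square X a b c d} \<union>
     {({a, b}, {b, c}) | a b c. is_triangle X a b c}"

text \<open>The closure is taken reflexively as well, so that an edge contained in no square and
  in no triangle forms a hyperplane by itself.\<close>

definition parallel :: "'v ugraph \<Rightarrow> ('v set \<times> 'v set) set" where
  "parallel X = (elementary_parallel X)\<^sup>* \<inter> edges X \<times> edges X"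

definition hyperplanes :: "'v ugraph \<Rightarrow> 'v set set set" where
  "hyperplanes X = edges X // parallel X"

definition transverse :: "'v ugraph \<Rightarrow> 'v set set \<Rightarrow> 'v set set \<Rightarrow> bool" where
  "transverse X J K \<longleftrightarrow>
     (\<exists>a b c d. is_square X a b c d \<and>
        {a, b} \<in> J \<and> {c, d} \<in> J \<and> {b, c} \<in> K \<and> {d, a} \<in> K)"


section \<open>Free products and graph products\<close>

definition fp_words :: "'v set \<Rightarrow> ('v \<Rightarrow> ('a, 'b) monoid_scheme) \<Rightarrow> ('v \<times> 'a) list set" where
  "fp_words I G = lists (SIGMA u:I. carrier (G u))"

inductive_set fp_rel ::
    "'v set \<Rightarrow> ('v \<Rightarrow> ('a, 'b) monoid_scheme) \<Rightarrow> (('v \<times> 'a) list \<times> ('v \<times> 'a) list) set"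
  for I G where
  refl: "w \<in> fp_words I G \<Longrightarrow> (w, w) \<in> fp_rel I G"
| sym: "(w, w') \<in> fp_rel I G \<Longrightarrow> (w', w) \<in> fp_rel I G"
| trans: "(w, w') \<in> fp_rel I G \<Longrightarrow> (w', w'') \<in> fp_rel I G \<Longrightarrow> (w, w'') \<in> fp_rel I G"
| unit: "xs \<in> fp_words I G \<Longrightarrow> ys \<in> fp_words I G \<Longrightarrow> u \<in> I \<Longrightarrow>
    (xs @ [(u, \<one>\<^bsub>G u\<^esub>)] @ ys, xs @ ys) \<in> fp_rel I G"
| mult: "xs \<in> fp_words I G \<Longrightarrow> ys \<in> fp_words I G \<Longrightarrow> u \<in> I \<Longrightarrow>
    g \<in> carrier (G u) \<Longrightarrow> h \<in> carrier (G u) \<Longrightarrow>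
    (xs @ [(u, g), (u, h)] @ ys, xs @ [(u, g \<otimes>\<^bsub>G u\<^esub> h)] @ ys) \<in> fp_rel I G"

definition free_product ::
    "'v set \<Rightarrow> ('v \<Rightarrow> ('a, 'b) monoid_scheme) \<Rightarrow> ('v \<times> 'a) list set monoid" where
  "free_product I G =
     \<lparr>carrier = fp_words I G // fp_rel I G,
      mult = (\<lambda>A B. \<Union>x\<in>A. \<Union>y\<in>B. fp_rel I G `` {x @ y}),
      one = fp_rel I G `` {[]}\<rparr>"

definition fp_inclusion ::
    "'v set \<Rightarrow> ('v \<Rightarrow> ('a, 'b) monoid_scheme) \<Rightarrow> 'v \<Rightarrow> 'a \<Rightarrow> ('v \<times> 'a) list set" where
  "fp_inclusion I G u g = fp_rel I G `` {[(u, g)]}"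

definition commutator :: "('a, 'b) monoid_scheme \<Rightarrow> 'a \<Rightarrow> 'a \<Rightarrow> 'a" where
  "commutator K x y = x \<otimes>\<^bsub>K\<^esub> y \<otimes>\<^bsub>K\<^esub> inv\<^bsub>K\<^esub> x \<otimes>\<^bsub>K\<^esub> inv\<^bsub>K\<^esub> y"

definition normal_closure :: "('a, 'b) monoid_scheme \<Rightarrow> 'a set \<Rightarrow> 'a set" where
  "normal_closure K S = \<Inter>{N. N \<lhd> K \<and> S \<subseteq> N}"

definition gp_kernel ::
    "'v ugraph \<Rightarrow> ('v \<Rightarrow> ('a, 'b) monoid_scheme) \<Rightarrow> ('v \<times> 'a) list set set" where
  "gp_kernel \<Gamma> G =
     normal_closure (free_product (verts \<Gamma>) G)
       {commutator (free_product (verts \<Gamma>) G)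
          (fp_inclusion (verts \<Gamma>) G u g) (fp_inclusion (verts \<Gamma>) G v h) | u v g h.
        {u, v} \<in> edges \<Gamma> \<and> g \<in> carrier (G u) \<and> h \<in> carrier (G v)}"

definition graph_product ::
    "'v ugraph \<Rightarrow> ('v \<Rightarrow> ('a, 'b) monoid_scheme) \<Rightarrow> ('v \<times> 'a) list set set monoid" where
  "graph_product \<Gamma> G = free_product (verts \<Gamma>) G Mod gp_kernel \<Gamma> G"

text \<open>The canonical image in the graph product of the vertex-group indexed by u.\<close>

definition vertex_subgroup ::
    "'v ugraph \<Rightarrow> ('v \<Rightarrow> ('a, 'b) monoid_scheme) \<Rightarrow> 'v \<Rightarrow> ('v \<times> 'a) list set set set" where
  "vertex_subgroup \<Gamma> G u =
     (\<lambda>g. gp_kernel \<Gamma> G #>\<^bsub>free_product (verts \<Gamma>) G\<^esub> fp_inclusion (verts \<Gamma>) G u g)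
       ` carrier (G u)"

definition conjugate_subgroup :: "('a, 'b) monoid_scheme \<Rightarrow> 'a \<Rightarrow> 'a set \<Rightarrow> 'a set" where
  "conjugate_subgroup K g H = g <#\<^bsub>K\<^esub> H #>\<^bsub>K\<^esub> inv\<^bsub>K\<^esub> g"

text \<open>Elementwise commutation, not merely equality of the product sets HL and LH.\<close>

definition commuting_subgroups :: "('a, 'b) monoid_scheme \<Rightarrow> 'a set \<Rightarrow> 'a set \<Rightarrow> bool" where
  "commuting_subgroups K H L \<longleftrightarrow> (\<forall>x\<in>H. \<forall>y\<in>L. x \<otimes>\<^bsub>K\<^esub> y = y \<otimes>\<^bsub>K\<^esub> x)"

definition small_crossing_graph ::
    "'v ugraph \<Rightarrow> ('v \<Rightarrow> ('a, 'b) monoid_scheme) \<Rightarrow> ('v \<times> 'a) list set set set ugraph" where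
  "small_crossing_graph \<Gamma> G =
     (let P = graph_product \<Gamma> G;
          C = {conjugate_subgroup P g (vertex_subgroup \<Gamma> G u) | g u.
                 g \<in> carrier P \<and> prec_maximal \<Gamma> u}
      in \<lparr>verts = C,
          edges = {{H, L} | H L. H \<in> C \<and> L \<in> C \<and> H \<noteq> L \<and> commuting_subgroups P H L}\<rparr>)"


section \<open>The Cayley graph QM and its labelled hyperplanes\<close>

definition cayley_graph :: "('a, 'b) monoid_scheme \<Rightarrow> 'a set \<Rightarrow> 'a ugraph" where
  "cayley_graph K S =
     \<lparr>verts = carrier K, edges = {{x, x \<otimes>\<^bsub>K\<^esub> s} | x s. x \<in> carrier K \<and> s \<in> S}\<rparr>"

definition QM ::
    "'v ugraph \<Rightarrow> ('v \<Rightarrow> ('a, 'b) monoid_scheme) \<Rightarrow> ('v \<times> 'a) list set set ugraph" where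
  "QM \<Gamma> G =
     cayley_graph (graph_product \<Gamma> G)
       ((\<Union>u\<in>verts \<Gamma>. vertex_subgroup \<Gamma> G u) - {\<one>\<^bsub>graph_product \<Gamma> G\<^esub>})"

definition base_hyperplane ::
    "'v ugraph \<Rightarrow> ('v \<Rightarrow> ('a, 'b) monoid_scheme) \<Rightarrow> 'v \<Rightarrow> ('v \<times> 'a) list set set set set" where
  "base_hyperplane \<Gamma> G u =
     (THE J. J \<in> hyperplanes (QM \<Gamma> G) \<and>
        edges (induced_subgraph (QM \<Gamma> G) (vertex_subgroup \<Gamma> G u)) \<subseteq> J)"

text \<open>The action on sets of edges induced by left multiplication on vertices.\<close>

definition translate :: "('a, 'b) monoid_scheme \<Rightarrow> 'a \<Rightarrow> 'a set set \<Rightarrow> 'a set set" where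
  "translate K g J = (\<lambda>e. g <#\<^bsub>K\<^esub> e) ` J"

definition labelled_by ::
    "'v ugraph \<Rightarrow> ('v \<Rightarrow> ('a, 'b) monoid_scheme) \<Rightarrow>
      ('v \<times> 'a) list set set set set \<Rightarrow> 'v \<Rightarrow> bool" where
  "labelled_by \<Gamma> G J u \<longleftrightarrow>
     (\<exists>g\<in>carrier (graph_product \<Gamma> G).
        J = translate (graph_product \<Gamma> G) g (base_hyperplane \<Gamma> G u))"

definition maximal_hyperplane_graph ::
    "'v ugraph \<Rightarrow> ('v \<Rightarrow> ('a, 'b) monoid_scheme) \<Rightarrow>
      ('v \<times> 'a) list set set set set ugraph" where
  "maximal_hyperplane_graph \<Gamma> G =
     (let W = {J \<in> hyperplanes (QM \<Gamma> G). \<exists>u. prec_maximal \<Gamma> u \<and> labelled_by \<Gamma> G J u}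
      in \<lparr>verts = W,
          edges = {{J, K} | J K. J \<in> W \<and> K \<in> W \<and> transverse (QM \<Gamma> G) J K}\<rparr>)"

end

theory Submission imports Defs begin

text \<open>
  Reduced words are considered up to shuffling of commuting letters. Each vertex-group acts on them by
  multiplying the letter that can be moved to the front; this action respects the relations of the
  graph product, so two reduced words with the same image are shuffles of each other. The normal form
  implies the key fact about parabolic subgroups: if \<open>p k = k t\<close> with \<open>p\<close> in the parabolic subgroup of
  a set \<open>\<Lambda>\<close> of vertices and \<open>t \<noteq> 1\<close> in the vertex-group of \<open>v\<close>, then \<open>v \<in> \<Lambda>\<close> and \<open>k\<close> is a product
  of an element of the parabolic subgroup of \<open>\<Lambda>\<close> and one of the parabolic subgroup of the star of \<open>v\<close>.
  Normal forms also show that a triangle of the Cayley graph has a single label and that a square is a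
  commutation square, so the conjugate \<open>x G\<^sub>u x\<inverse>\<close> attached to an edge labelled by \<open>u\<close> at \<open>x\<close> depends
  only on its hyperplane. The key fact, applied to \<open>\<Lambda> = {u}\<close> and to the star of \<open>u\<close>, gives injectivity
  and turns commuting conjugates into transverse hyperplanes.
\<close>

section \<open>Hyperplanes of a graph and normal closures\<close>

lemma is_square_rotate: "is_square X a b c d \<Longrightarrow> is_square X b c d a"
  by (auto simp: is_square_def insert_commute)

lemma sym_elementary_parallel: "sym (elementary_parallel X)"
proof (rule symI)
  fix e e' assume "(e, e') \<in> elementary_parallel X"
  then consider (square) a b c d where "e = {a, b}" "e' = {c, d}" "is_square X a b c d"
    | (triangle) a b c where "e = {a, b}" "e' = {b, c}" "is_triangle X a b c"
    by (auto simp: elementary_parallel_def)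
  then show "(e', e) \<in> elementary_parallel X"
  proof cases
    case square
    have "is_square X c d a b" by (rule is_square_rotate[OF is_square_rotate[OF square(3)]])
    then show ?thesis using square by (auto simp: elementary_parallel_def)
  next
    case triangle
    then have "is_triangle X c b a" by (auto simp: is_triangle_def insert_commute)
    moreover have "e' = {c, b}" "e = {b, a}" using triangle by auto
    ultimately show ?thesis unfolding elementary_parallel_def by blast
  qed
qed

text \<open>Hyperplanes are therefore genuine equivalence classes: two of them sharing an edge
  coincide.\<close>

lemma equiv_parallel: "equiv (edges X) (parallel X)"
proof (rule equivI)
  show "parallel X \<subseteq> edges X \<times> edges X" by (auto simp: parallel_def)
  show "refl_on (edges X) (parallel X)" by (auto simp: parallel_def refl_on_def)
  show "sym (parallel X)"
    using sym_rtrancl[OF sym_elementary_parallel, of X] by (auto simp: parallel_def sym_def)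
  show "trans (parallel X)" by (auto simp: parallel_def trans_def)
qed

lemma parallel_square:
  assumes "is_square X a b c d"
  shows "({a, b}, {c, d}) \<in> parallel X"
proof -
  have "({a, b}, {c, d}) \<in> elementary_parallel X"
    using assms by (auto simp: elementary_parallel_def)
  then show ?thesis using assms by (auto simp: parallel_def is_square_def)
qed

lemma parallel_triangle:
  assumes "is_triangle X a b c"
  shows "({a, b}, {b, c}) \<in> parallel X"
proof -
  have "({a, b}, {b, c}) \<in> elementary_parallel X"
    using assms by (auto simp: elementary_parallel_def)
  then show ?thesis using assms by (auto simp: parallel_def is_triangle_def)
qed

lemma transverse_sym: "transverse X J H \<Longrightarrow> transverse X H J"
proof -
  assume "transverse X J H"
  then obtain a b c d where sq: "is_square X a b c d"
    "{a, b} \<in> J" "{c, d} \<in> J" "{b, c} \<in> H" "{d, a} \<in> H"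
    unfolding transverse_def by blast
  show ?thesis
    unfolding transverse_def using is_square_rotate[OF sq(1)] sq(2-5) by blast
qed

text \<open>An unordered pair \<open>{x, y}\<close> may be listed as \<open>(x, y)\<close> or
  \<open>(y, x)\<close>; symmetry of \<open>R\<close> makes both readings agree.\<close>

lemma pair_in_edges_iff:
  assumes "\<And>x y. R x y \<Longrightarrow> R y x" "x \<in> C" "y \<in> C"
  shows "{x, y} \<in> {{a, b} | a b. a \<in> C \<and> b \<in> C \<and> R a b} \<longleftrightarrow> R x y"
  using assms by (auto simp: doubleton_eq_iff)

lemma normal_closure_normal:
  assumes "group H" "S \<subseteq> carrier H"
  shows "normal_closure H S \<lhd> H" "S \<subseteq> normal_closure H S"
proof -
  interpret H: group H by fact
  \<comment> \<open>The whole group belongs to the family being intersected, so this family is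
    nonempty.\<close>
  have "carrier H \<lhd> H" by (auto simp: H.normal_inv_iff H.subgroup_self)
  then have "subgroup (normal_closure H S) H"
    unfolding normal_closure_def using assms
    by (intro H.subgroups_Inter) (auto simp: H.normal_inv_iff)
  then show "normal_closure H S \<lhd> H"
    by (auto simp: H.normal_inv_iff normal_closure_def)
  show "S \<subseteq> normal_closure H S" by (auto simp: normal_closure_def)
qed

section \<open>Graphs of groups\<close>

locale graph_of_groups =
  fixes \<Gamma> :: "'v ugraph" and G :: "'v \<Rightarrow> ('a, 'b) monoid_scheme"
  assumes simplicial: "simplicial_graph \<Gamma>"
    and vertex_group: "\<And>u. u \<in> verts \<Gamma> \<Longrightarrow> group (G u)"
    and nontrivial: "\<And>u. u \<in> verts \<Gamma> \<Longrightarrow> carrier (G u) \<noteq> {\<one>\<^bsub>G u\<^esub>}"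
begin

definition adj :: "'v \<Rightarrow> 'v \<Rightarrow> bool" where
  "adj u v \<longleftrightarrow> {u, v} \<in> edges \<Gamma>"

lemma adj_irrefl [simp]: "\<not> adj u u"
  using simplicial by (fastforce simp: adj_def simplicial_graph_def doubleton_eq_iff)

lemma adj_sym: "adj u v \<longleftrightarrow> adj v u"
  by (simp add: adj_def insert_commute)

lemma adj_verts: "adj u v \<Longrightarrow> u \<in> verts \<Gamma> \<and> v \<in> verts \<Gamma>"
  using simplicial by (fastforce simp: adj_def simplicial_graph_def doubleton_eq_iff)

abbreviation W :: "('v \<times> 'a) list set" where
  "W \<equiv> fp_words (verts \<Gamma>) G"

lemma W_Nil [simp]: "[] \<in> W"
  by (simp add: fp_words_def)

lemma W_Cons [simp]:
  "(u, g) # w \<in> W \<longleftrightarrow> u \<in> verts \<Gamma> \<and> g \<in> carrier (G u) \<and> w \<in> W"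
  by (auto simp: fp_words_def)

lemma W_append [simp]: "w @ w' \<in> W \<longleftrightarrow> w \<in> W \<and> w' \<in> W"
  by (auto simp: fp_words_def)

lemma vertex_closed [simp]:
  assumes "u \<in> verts \<Gamma>"
  shows "\<one>\<^bsub>G u\<^esub> \<in> carrier (G u)"
    and "g \<in> carrier (G u) \<Longrightarrow> inv\<^bsub>G u\<^esub> g \<in> carrier (G u)"
    and "g \<in> carrier (G u) \<Longrightarrow> h \<in> carrier (G u) \<Longrightarrow> g \<otimes>\<^bsub>G u\<^esub> h \<in> carrier (G u)"
    and "g \<in> carrier (G u) \<Longrightarrow> \<one>\<^bsub>G u\<^esub> \<otimes>\<^bsub>G u\<^esub> g = g"
    and "g \<in> carrier (G u) \<Longrightarrow> g \<otimes>\<^bsub>G u\<^esub> \<one>\<^bsub>G u\<^esub> = g"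
    and "g \<in> carrier (G u) \<Longrightarrow> inv\<^bsub>G u\<^esub> g \<otimes>\<^bsub>G u\<^esub> g = \<one>\<^bsub>G u\<^esub>"
    and "g \<in> carrier (G u) \<Longrightarrow> g \<otimes>\<^bsub>G u\<^esub> inv\<^bsub>G u\<^esub> g = \<one>\<^bsub>G u\<^esub>"
proof -
  interpret group "G u" using assms by (rule vertex_group)
  show "\<one>\<^bsub>G u\<^esub> \<in> carrier (G u)"
    and "g \<in> carrier (G u) \<Longrightarrow> inv\<^bsub>G u\<^esub> g \<in> carrier (G u)"
    and "g \<in> carrier (G u) \<Longrightarrow> h \<in> carrier (G u) \<Longrightarrow> g \<otimes>\<^bsub>G u\<^esub> h \<in> carrier (G u)"
    and "g \<in> carrier (G u) \<Longrightarrow> \<one>\<^bsub>G u\<^esub> \<otimes>\<^bsub>G u\<^esub> g = g"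
    and "g \<in> carrier (G u) \<Longrightarrow> g \<otimes>\<^bsub>G u\<^esub> \<one>\<^bsub>G u\<^esub> = g"
    and "g \<in> carrier (G u) \<Longrightarrow> inv\<^bsub>G u\<^esub> g \<otimes>\<^bsub>G u\<^esub> g = \<one>\<^bsub>G u\<^esub>"
    and "g \<in> carrier (G u) \<Longrightarrow> g \<otimes>\<^bsub>G u\<^esub> inv\<^bsub>G u\<^esub> g = \<one>\<^bsub>G u\<^esub>"
    by simp_all
qed

section \<open>Reduced words and shuffles\<close>

text \<open>The group element on the \<open>u\<close>-letter that commutations can bring to the
  front. The default value one, when there is no such letter, is what makes left multiplication by
  \<open>G u\<close> uniform in \<open>act\<close>.\<close>

fun head :: "'v \<Rightarrow> ('v \<times> 'a) list \<Rightarrow> 'a" where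
  "head u [] = \<one>\<^bsub>G u\<^esub>"
| "head u ((v, h) # w) = (if v = u then h else if adj u v then head u w else \<one>\<^bsub>G u\<^esub>)"

fun tail :: "'v \<Rightarrow> ('v \<times> 'a) list \<Rightarrow> ('v \<times> 'a) list" where
  "tail u [] = []"
| "tail u ((v, h) # w) =
    (if v = u then w else if adj u v then (v, h) # tail u w else (v, h) # w)"

text \<open>The condition on \<open>head u w\<close> forbids a later \<open>u\<close>-letter from
  being shuffled next to the first one. Letters of a reduced word are non-trivial, so there the
  value one of \<open>head\<close> really means that no such letter exists.\<close>

fun reduced :: "('v \<times> 'a) list \<Rightarrow> bool" where
  "reduced [] \<longleftrightarrow> True"
| "reduced ((u, g) # w) \<longleftrightarrow>
    u \<in> verts \<Gamma> \<and> g \<in> carrier (G u) \<and> g \<noteq> \<one>\<^bsub>G u\<^esub> \<and> head u w = \<one>\<^bsub>G u\<^esub> \<and> reduced w"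

inductive shuffle :: "('v \<times> 'a) list \<Rightarrow> ('v \<times> 'a) list \<Rightarrow> bool" where
  shuffle_refl [simp]: "shuffle w w"
| shuffle_Cons: "shuffle w w' \<Longrightarrow> shuffle (a # w) (a # w')"
| shuffle_swap: "adj u v \<Longrightarrow> shuffle ((u, g) # (v, h) # w) ((v, h) # (u, g) # w)"
| shuffle_trans [trans]: "shuffle w w' \<Longrightarrow> shuffle w' w'' \<Longrightarrow> shuffle w w''"

lemma shuffle_sym: "shuffle w w' \<Longrightarrow> shuffle w' w"
proof (induction rule: shuffle.induct)
  case (shuffle_trans w w' w'')
  then show ?case by (blast intro: shuffle.shuffle_trans)
qed (auto intro: shuffle_Cons shuffle_swap simp: adj_sym)

text \<open>Two swapped letters have adjacent, hence distinct, labels: neither prevents the other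
  from reaching the front.\<close>

lemma shuffle_head: "shuffle w w' \<Longrightarrow> head u w = head u w'"
proof (induction rule: shuffle.induct)
  case (shuffle_Cons w w' a)
  then show ?case by (cases a) auto
qed (auto simp: adj_sym)

lemma shuffle_tail: "shuffle w w' \<Longrightarrow> shuffle (tail u w) (tail u w')"
proof (induction rule: shuffle.induct)
  case (shuffle_Cons w w' a)
  then show ?case by (cases a) (auto intro: shuffle.shuffle_Cons)
next
  case (shuffle_trans w w' w'')
  then show ?case by (blast intro: shuffle.shuffle_trans)
qed (auto intro: shuffle_Cons shuffle_swap simp: adj_sym)

lemma shuffle_reduced: "shuffle w w' \<Longrightarrow> reduced w \<longleftrightarrow> reduced w'"
proof (induction rule: shuffle.induct)
  case (shuffle_Cons w w' a)
  then show ?case by (cases a) (auto simp: shuffle_head)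
qed (auto simp: adj_sym)

lemma shuffle_set: "shuffle w w' \<Longrightarrow> set w = set w' \<and> length w = length w'"
  by (induction rule: shuffle.induct) auto

lemma shuffle_count: "shuffle w w' \<Longrightarrow> count_list w a = count_list w' a"
  by (induction rule: shuffle.induct) auto

lemma shuffle_rotate:
  "\<forall>(x, k) \<in> set w. adj u x \<Longrightarrow> shuffle ((u, g) # w @ z) (w @ (u, g) # z)"
proof (induction w)
  case (Cons a w)
  obtain x k where a: "a = (x, k)" by (cases a)
  have "shuffle ((u, g) # a # w @ z) (a # (u, g) # w @ z)"
    using Cons.prems a by (auto intro: shuffle_swap)
  also have "shuffle \<dots> (a # w @ (u, g) # z)"
    using Cons by (auto intro: shuffle_Cons)
  finally show ?case by simp
qed simp

lemma reduced_in_W: "reduced w \<Longrightarrow> w \<in> W"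
  by (induction w rule: reduced.induct) auto

lemma head_closed: "w \<in> W \<Longrightarrow> u \<in> verts \<Gamma> \<Longrightarrow> head u w \<in> carrier (G u)"
  by (induction u w rule: head.induct) auto

lemma tail_in_W: "w \<in> W \<Longrightarrow> tail u w \<in> W"
  by (induction u w rule: tail.induct) auto

lemma tail_trivial: "reduced w \<Longrightarrow> head u w = \<one>\<^bsub>G u\<^esub> \<Longrightarrow> tail u w = w"
  by (induction u w rule: tail.induct) (auto split: if_splits)

text \<open>A \<open>u\<close>-letter never blocks a \<open>v\<close>-letter when \<open>u\<close>
  and \<open>v\<close> are adjacent, so deleting one changes nothing for \<open>v\<close>.\<close>

lemma head_tail_adj: "adj u v \<Longrightarrow> head v (tail u w) = head v w"
  by (induction u w rule: tail.induct) (auto simp: adj_sym)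

lemma tail_commute: "adj u v \<Longrightarrow> tail u (tail v w) = tail v (tail u w)"
  by (induction u w rule: tail.induct) (auto simp: adj_sym)

lemma reduced_tail: "reduced w \<Longrightarrow> reduced (tail u w)"
  by (induction u w rule: tail.induct) (auto simp: head_tail_adj)

text \<open>If a second \<open>u\<close>-letter could surface after the first is deleted, the two
  could have been merged in \<open>w\<close>.\<close>

lemma head_tail: "reduced w \<Longrightarrow> head u (tail u w) = \<one>\<^bsub>G u\<^esub>"
  by (induction u w rule: tail.induct) auto

lemma shuffle_head_tail:
  "head u w \<noteq> \<one>\<^bsub>G u\<^esub> \<Longrightarrow> shuffle ((u, head u w) # tail u w) w"
proof (induction u w rule: tail.induct)
  case (2 u v h w)
  show ?case
  proof (cases "v = u \<or> \<not> adj u v")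
    case False
    then have "shuffle ((u, head u w) # (v, h) # tail u w) ((v, h) # (u, head u w) # tail u w)"
      by (auto intro: shuffle_swap)
    also have "shuffle \<dots> ((v, h) # w)"
      using False 2 by (auto intro: shuffle_Cons)
    finally show ?thesis using False by auto
  qed (use 2 in auto)
qed simp

lemma length_tail: "head u w \<noteq> \<one>\<^bsub>G u\<^esub> \<Longrightarrow> length w = Suc (length (tail u w))"
  by (induction u w rule: tail.induct) (auto split: if_splits)

text \<open>A \<open>u\<close>-letter inside \<open>w\<close> also counts as blocking, because
  \<open>adj\<close> is irreflexive; this is why two cases suffice.\<close>

lemma head_append:
  "head u (w @ z) = (if \<forall>(x, k) \<in> set w. adj u x then head u z else head u w)"
  by (induction w) auto

lemma head_adj: "\<forall>(x, k) \<in> set w. adj u x \<Longrightarrow> head u w = \<one>\<^bsub>G u\<^esub>"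
  by (induction w) auto

lemma reduced_append:
  "reduced w \<Longrightarrow> reduced z \<Longrightarrow> (\<And>x k. (x, k) \<in> set w \<Longrightarrow> head x z = \<one>\<^bsub>G x\<^esub>) \<Longrightarrow> reduced (w @ z)"
  by (induction w rule: reduced.induct) (auto simp: head_append)

lemma reduced_appendD: "reduced (w @ z) \<Longrightarrow> reduced w"
  by (induction w rule: reduced.induct) (auto simp: head_append head_adj split: if_splits)

text \<open>The right-hand counterpart of \<open>head\<close>: appending a letter can spoil
  reducedness only if a letter with the same label can be moved to the end of
  \<open>w\<close>.\<close>

lemma reduced_snoc:
  assumes "reduced w" "v \<in> verts \<Gamma>" "t \<in> carrier (G v)" "t \<noteq> \<one>\<^bsub>G v\<^esub>"
  shows "reduced (w @ [(v, t)]) \<or> (\<exists>w' k. shuffle w (w' @ [(v, k)]))"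
  using assms(1)
proof (induction w rule: reduced.induct)
  case (2 u g w)
  then consider "reduced (w @ [(v, t)])" | w' k where "shuffle w (w' @ [(v, k)])"
    by auto
  then show ?case
  proof cases
    case 1
    show ?thesis
    proof (cases "head u (w @ [(v, t)]) = \<one>\<^bsub>G u\<^esub>")
      case False
      \<comment> \<open>Since \<open>head u w\<close> is trivial, the letter that surfaces is the
        appended one, so it commutes past all of \<open>w\<close>. By symmetry the leading letter
        can travel to the end.\<close>
      then have "u = v" "\<forall>(x, k) \<in> set w. adj u x"
        using 2 by (auto simp: head_append split: if_splits)
      then have "shuffle ((u, g) # w) (w @ [(v, g)])"
        using shuffle_rotate[of w u g "[]"] by simp
      then show ?thesis by blast
    qed (use 1 2 in auto)
  next
    case 2
    then have "shuffle ((u, g) # w) (((u, g) # w') @ [(v, k)])"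
      by (auto intro: shuffle_Cons)
    then show ?thesis by blast
  qed
qed (use assms in auto)

section \<open>The action on reduced words\<close>

definition ncons :: "'v \<Rightarrow> 'a \<Rightarrow> ('v \<times> 'a) list \<Rightarrow> ('v \<times> 'a) list" where
  "ncons u g w = (if g = \<one>\<^bsub>G u\<^esub> then w else (u, g) # w)"

text \<open>Left multiplication on normal forms: creation, modification and cancellation of a letter
  are all covered, thanks to the default of \<open>head\<close> and the dropping of trivial letters
  by \<open>ncons\<close>.\<close>

fun act :: "'v \<times> 'a \<Rightarrow> ('v \<times> 'a) list \<Rightarrow> ('v \<times> 'a) list" where
  "act (u, g) w = ncons u (g \<otimes>\<^bsub>G u\<^esub> head u w) (tail u w)"

lemma reduced_act:
  "reduced w \<Longrightarrow> u \<in> verts \<Gamma> \<Longrightarrow> g \<in> carrier (G u) \<Longrightarrow> reduced (act (u, g) w)"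
  by (auto simp: ncons_def reduced_tail head_tail head_closed reduced_in_W)

lemma shuffle_act: "shuffle w w' \<Longrightarrow> shuffle (act a w) (act a w')"
  by (cases a) (auto simp: ncons_def shuffle_head intro: shuffle_Cons shuffle_tail)

text \<open>After acting by \<open>h\<close>, the front \<open>u\<close>-value is \<open>h\<close>
  times the old one and the remainder is \<open>tail u w\<close>, even if the new letter has
  cancelled.\<close>

lemma act_mult:
  assumes "reduced w" "u \<in> verts \<Gamma>" "g \<in> carrier (G u)" "h \<in> carrier (G u)"
  shows "act (u, g) (act (u, h) w) = act (u, g \<otimes>\<^bsub>G u\<^esub> h) w"
proof -
  interpret group "G u" using assms by (intro vertex_group)
  have "head u w \<in> carrier (G u)" using assms by (simp add: head_closed reduced_in_W)
  then show ?thesis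
    using assms
    by (auto simp: ncons_def head_tail tail_trivial reduced_tail m_assoc)
qed

text \<open>Equality would be too strong: acting by one pulls the movable \<open>u\<close>-letter of
  \<open>w\<close>, if any, to the front.\<close>

lemma act_one:
  assumes "reduced w" "u \<in> verts \<Gamma>"
  shows "shuffle (act (u, \<one>\<^bsub>G u\<^esub>) w) w"
  using assms
  by (auto simp: ncons_def tail_trivial head_closed reduced_in_W shuffle_head_tail)

text \<open>Letters with adjacent labels do not see each other's \<open>head\<close>, and their
  \<open>tail\<close> operations commute; at most one final swap remains.\<close>

lemma act_commute:
  assumes "adj u v"
  shows "shuffle (act (u, g) (act (v, h) w)) (act (v, h) (act (u, g) w))"
proof -
  have "u \<noteq> v" "adj v u" using assms by (auto simp: adj_sym)
  then show ?thesis
    using assms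
    by (auto simp: ncons_def head_tail_adj tail_commute[of u v] intro: shuffle_swap)
qed

abbreviation acts :: "('v \<times> 'a) list \<Rightarrow> ('v \<times> 'a) list \<Rightarrow> ('v \<times> 'a) list" where
  "acts \<equiv> foldr act"

lemma reduced_acts: "w \<in> W \<Longrightarrow> reduced x \<Longrightarrow> reduced (acts w x)"
proof (induction w)
  case (Cons a w)
  then show ?case by (cases a) (simp add: reduced_act del: act.simps)
qed simp

lemma shuffle_acts: "shuffle x x' \<Longrightarrow> shuffle (acts w x) (acts w x')"
  by (induction w) (auto intro: shuffle_act)

text \<open>The orbit of the empty word recovers reduced words, which lets the action tell group
  elements apart.\<close>

lemma acts_reduced: "reduced w \<Longrightarrow> acts w [] = w"
  by (induction w rule: reduced.induct) (auto simp: ncons_def tail_trivial)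

lemma labels_tail: "fst ` set (tail u w) \<subseteq> fst ` set w"
  by (induction u w rule: tail.induct) auto

lemma labels_acts: "fst ` set (acts w []) \<subseteq> fst ` set w"
proof (induction w)
  case (Cons a w)
  obtain u g where a: "a = (u, g)" by (cases a)
  have "fst ` set (act a (acts w [])) \<subseteq> insert u (fst ` set (acts w []))"
    using labels_tail[of u "acts w []"] by (auto simp: a ncons_def)
  also have "\<dots> \<subseteq> fst ` set (a # w)"
    using Cons by (simp add: a subset_insertI2)
  finally show ?case by simp
qed simp

lemma fp_rel_W: "(w, w') \<in> fp_rel (verts \<Gamma>) G \<Longrightarrow> w \<in> W \<and> w' \<in> W"
  by (induction rule: fp_rel.induct) auto

text \<open>The action on reduced words up to shuffle descends to the free product.\<close>

lemma fp_rel_acts: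
  "(w, w') \<in> fp_rel (verts \<Gamma>) G \<Longrightarrow> reduced x \<Longrightarrow> shuffle (acts w x) (acts w' x)"
proof (induction rule: fp_rel.induct)
  case (unit xs ys u)
  then show ?case
    by (simp del: act.simps) (intro shuffle_acts act_one reduced_acts; assumption)
next
  case (mult xs ys u g h)
  then show ?case by (simp add: act_mult reduced_acts del: act.simps)
next
  case (sym w w')
  then show ?case by (blast intro: shuffle_sym)
next
  case (trans w w' w'')
  then show ?case by (blast intro: shuffle_trans)
qed simp

section \<open>The free product and the graph product as groups\<close>

abbreviation rel where "rel \<equiv> fp_rel (verts \<Gamma>) G"
abbreviation FP where "FP \<equiv> free_product (verts \<Gamma>) G"
abbreviation K where "K \<equiv> gp_kernel \<Gamma> G"
abbreviation P where "P \<equiv> graph_product \<Gamma> G"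

definition cls :: "('v \<times> 'a) list \<Rightarrow> ('v \<times> 'a) list set" where
  "cls w = rel `` {w}"

definition winv :: "('v \<times> 'a) list \<Rightarrow> ('v \<times> 'a) list" where
  "winv w = rev (map (\<lambda>(u, g). (u, inv\<^bsub>G u\<^esub> g)) w)"

lemma winv_W: "w \<in> W \<Longrightarrow> winv w \<in> W"
  by (induction w) (auto simp: winv_def)

lemma equiv_rel: "equiv W rel"
proof (rule equivI)
  show "rel \<subseteq> W \<times> W" by (auto dest: fp_rel_W)
  show "refl_on W rel" by (auto simp: refl_on_def intro: fp_rel.refl)
  show "sym rel" by (auto simp: sym_def intro: fp_rel.sym)
  show "trans rel" by (auto simp: trans_def intro: fp_rel.trans)
qed

lemma cls_eq_iff: "w \<in> W \<Longrightarrow> w' \<in> W \<Longrightarrow> cls w = cls w' \<longleftrightarrow> (w, w') \<in> rel"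
  unfolding cls_def by (rule eq_equiv_class_iff[OF equiv_rel])

lemma fp_rel_context: "(w, w') \<in> rel \<Longrightarrow> a \<in> W \<Longrightarrow> b \<in> W \<Longrightarrow> (a @ w @ b, a @ w' @ b) \<in> rel"
proof (induction rule: fp_rel.induct)
  case (unit xs ys u)
  then show ?case using fp_rel.unit[of "a @ xs" "verts \<Gamma>" G "ys @ b" u] by simp
next
  case (mult xs ys u g h)
  then show ?case using fp_rel.mult[of "a @ xs" "verts \<Gamma>" G "ys @ b" u g h] by simp
next
  case (refl w)
  then show ?case by (simp add: fp_rel.refl)
next
  case (sym w w')
  then show ?case by (blast intro: fp_rel.sym)
next
  case (trans w w' w'')
  then show ?case by (blast intro: fp_rel.trans)
qed

lemma fp_rel_append:
  assumes "(w, w') \<in> rel" "(z, z') \<in> rel"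
  shows "(w @ z, w' @ z') \<in> rel"
proof -
  have "(w @ z, w' @ z) \<in> rel"
    using fp_rel_context[OF assms(1), of "[]" z] fp_rel_W[OF assms(2)] by simp
  moreover have "(w' @ z, w' @ z') \<in> rel"
    using fp_rel_context[OF assms(2), of w' "[]"] fp_rel_W[OF assms(1)] by simp
  ultimately show ?thesis by (rule fp_rel.trans)
qed

lemma carrier_FP: "carrier FP = cls ` W"
  by (auto simp: free_product_def cls_def quotient_def)

text \<open>The product is defined as a union over all representatives; since the relation is a
  congruence, every member of the union is the same class.\<close>

lemma mult_FP:
  assumes "w \<in> W" "z \<in> W"
  shows "cls w \<otimes>\<^bsub>FP\<^esub> cls z = cls (w @ z)"
proof -
  have "cls (x @ y) = cls (w @ z)" if xy: "x \<in> cls w" "y \<in> cls z" for x y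
  proof -
    have "(w, x) \<in> rel" "(z, y) \<in> rel" using xy by (simp_all add: cls_def)
    then show ?thesis
      using fp_rel_append[of w x z y] fp_rel_W[of w x] fp_rel_W[of z y]
        cls_eq_iff[of "w @ z" "x @ y"] by simp
  qed
  then have "(\<Union>x\<in>cls w. \<Union>y\<in>cls z. cls (x @ y)) = (\<Union>x\<in>cls w. \<Union>y\<in>cls z. cls (w @ z))"
    by (intro SUP_cong) simp_all
  moreover have "w \<in> cls w" "z \<in> cls z"
    using assms by (simp_all add: cls_def fp_rel.refl)
  ultimately show ?thesis
    by (auto simp: free_product_def cls_def[symmetric])
qed

text \<open>The innermost pair of mutually inverse letters cancels first, leaving the same statement
  for the shorter word.\<close>

lemma winv_left: "w \<in> W \<Longrightarrow> (winv w @ w, []) \<in> rel"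
proof (induction w)
  case (Cons a w)
  obtain u g where a: "a = (u, g)" by (cases a)
  have w: "w \<in> W" "winv w \<in> W" "u \<in> verts \<Gamma>" "g \<in> carrier (G u)"
    using Cons.prems a by (auto intro: winv_W)
  have "(winv w @ [(u, inv\<^bsub>G u\<^esub> g), (u, g)] @ w, winv w @ [(u, inv\<^bsub>G u\<^esub> g \<otimes>\<^bsub>G u\<^esub> g)] @ w) \<in> rel"
    using w by (intro fp_rel.mult) auto
  also have "inv\<^bsub>G u\<^esub> g \<otimes>\<^bsub>G u\<^esub> g = \<one>\<^bsub>G u\<^esub>" using w by simp
  also have "(winv w @ [(u, \<one>\<^bsub>G u\<^esub>)] @ w, winv w @ w) \<in> rel"
    using w by (intro fp_rel.unit) auto
  also (fp_rel.trans) have "(winv w @ w, []) \<in> rel" using Cons w by blast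
  finally (fp_rel.trans) show ?case by (simp add: a winv_def)
qed (simp add: winv_def fp_rel.refl)

lemma one_FP: "\<one>\<^bsub>FP\<^esub> = cls []"
  by (simp add: free_product_def cls_def)

lemma group_FP: "group FP"
proof (rule groupI)
  fix x y assume "x \<in> carrier FP" "y \<in> carrier FP"
  then show "x \<otimes>\<^bsub>FP\<^esub> y \<in> carrier FP"
    unfolding carrier_FP by (elim imageE) (simp add: mult_FP)
next
  fix x y z assume "x \<in> carrier FP" "y \<in> carrier FP" "z \<in> carrier FP"
  then show "x \<otimes>\<^bsub>FP\<^esub> y \<otimes>\<^bsub>FP\<^esub> z = x \<otimes>\<^bsub>FP\<^esub> (y \<otimes>\<^bsub>FP\<^esub> z)"
    unfolding carrier_FP by (elim imageE) (simp add: mult_FP)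
next
  fix x assume x: "x \<in> carrier FP"
  then show "\<one>\<^bsub>FP\<^esub> \<otimes>\<^bsub>FP\<^esub> x = x"
    unfolding carrier_FP one_FP by (elim imageE) (simp add: mult_FP)
  obtain w where w: "w \<in> W" "x = cls w" using x by (auto simp: carrier_FP)
  then have "cls (winv w) \<otimes>\<^bsub>FP\<^esub> x = \<one>\<^bsub>FP\<^esub>"
    using winv_left[of w] winv_W[of w] by (simp add: mult_FP one_FP cls_eq_iff)
  then show "\<exists>y\<in>carrier FP. y \<otimes>\<^bsub>FP\<^esub> x = \<one>\<^bsub>FP\<^esub>"
    using w winv_W[of w] by (auto simp: carrier_FP)
qed (simp add: carrier_FP one_FP)

sublocale FP: group FP by (rule group_FP)

lemma inv_FP: "w \<in> W \<Longrightarrow> inv\<^bsub>FP\<^esub> (cls w) = cls (winv w)"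
  using winv_left[of w] winv_W[of w]
  by (intro FP.inv_equality) (simp_all add: mult_FP one_FP cls_eq_iff carrier_FP)

section \<open>The defining relators and the quotient group\<close>

definition relators :: "('v \<times> 'a) list set set" where
  "relators = {commutator FP (cls [(u, g)]) (cls [(v, h)]) | u v g h.
     adj u v \<and> g \<in> carrier (G u) \<and> h \<in> carrier (G v)}"

lemma gp_kernel_eq: "K = normal_closure FP relators"
  by (simp add: gp_kernel_def relators_def fp_inclusion_def cls_def adj_def)

lemma relators_closed: "relators \<subseteq> carrier FP"
proof -
  have "cls [(u, g)] \<in> carrier FP" if "u \<in> verts \<Gamma>" "g \<in> carrier (G u)" for u g
    using that by (auto simp: carrier_FP)
  then show ?thesis using adj_verts by (fastforce simp: relators_def commutator_def)
qed

lemma normal_K: "K \<lhd> FP" and relators_K: "relators \<subseteq> K"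
  using normal_closure_normal[OF group_FP relators_closed] by (simp_all add: gp_kernel_eq)

sublocale K: normal K FP by (rule normal_K)

lemma group_P: "group P"
  unfolding graph_product_def by (rule K.factorgroup_is_group)

sublocale P: group P by (rule group_P)

section \<open>The kernel of the quotient map acts trivially on reduced words\<close>

definition acts_trivially :: "('v \<times> 'a) list \<Rightarrow> bool" where
  "acts_trivially w \<longleftrightarrow> (\<forall>x. reduced x \<longrightarrow> shuffle (acts w x) x)"

lemma acts_trivially_rel: "(w, w') \<in> rel \<Longrightarrow> acts_trivially w \<Longrightarrow> acts_trivially w'"
  unfolding acts_trivially_def by (meson fp_rel_acts shuffle_sym shuffle_trans)

lemma acts_trivially_Nil: "acts_trivially []"
  by (simp add: acts_trivially_def)

text \<open>The suffix \<open>z\<close> sends a reduced word to a reduced word, on which the block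
  \<open>w\<close> does nothing up to shuffle; the prefix \<open>a\<close> preserves
  shuffles.\<close>

lemma acts_trivially_insert:
  assumes "acts_trivially w" "z \<in> W"
  shows "acts_trivially (a @ w @ z) \<longleftrightarrow> acts_trivially (a @ z)"
proof -
  have "shuffle (acts (a @ w @ z) x) (acts (a @ z) x)" if "reduced x" for x
    using assms that by (simp add: acts_trivially_def reduced_acts shuffle_acts)
  then show ?thesis unfolding acts_trivially_def by (meson shuffle_sym shuffle_trans)
qed

lemma acts_trivially_winv:
  assumes "w \<in> W" "acts_trivially w"
  shows "acts_trivially (winv w)"
proof -
  have "acts_trivially (winv w @ w @ [])"
    using acts_trivially_rel[OF fp_rel.sym[OF winv_left[OF assms(1)]] acts_trivially_Nil] by simp
  then show ?thesis using assms by (subst (asm) acts_trivially_insert) auto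
qed

text \<open>Turns the left cancellation of \<open>winv_left\<close> into cancellation on the
  right.\<close>

lemma winv_winv: "w \<in> W \<Longrightarrow> winv (winv w) = w"
proof (induction w)
  case (Cons a w)
  obtain u g where a: "a = (u, g)" by (cases a)
  interpret Gu: group "G u" using Cons a by (auto intro: vertex_group)
  show ?case using Cons a by (simp add: winv_def rev_map)
qed (simp add: winv_def)

text \<open>The classes acting trivially form a normal subgroup containing the relators, hence
  containing their normal closure.\<close>

lemma K_acts_trivially:
  assumes "w \<in> W" "cls w \<in> K"
  shows "acts_trivially w"
proof -
  define N where "N = {cls w | w. w \<in> W \<and> acts_trivially w}"
  \<comment> \<open>Membership in \<open>N\<close> is independent of the chosen
    representative.\<close>
  have N: "cls w \<in> N \<longleftrightarrow> acts_trivially w" if "w \<in> W" for w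
  proof -
    have "acts_trivially w" if "w' \<in> W" "cls w = cls w'" "acts_trivially w'" for w'
      using that \<open>w \<in> W\<close> cls_eq_iff[of w' w] acts_trivially_rel[of w' w] by simp
    then show ?thesis using that unfolding N_def by blast
  qed
  have sub: "N \<subseteq> cls ` W" by (auto simp: N_def)
  have "subgroup N FP"
  proof
    show "N \<subseteq> carrier FP" using sub by (simp add: carrier_FP)
    show "\<one>\<^bsub>FP\<^esub> \<in> N" by (simp add: one_FP N acts_trivially_Nil)
  next
    fix x y assume xy: "x \<in> N" "y \<in> N"
    then obtain w z where wz: "x = cls w" "y = cls z" "w \<in> W" "z \<in> W"
      using sub by blast
    show "x \<otimes>\<^bsub>FP\<^esub> y \<in> N"
      using xy wz acts_trivially_insert[of w z "[]"] by (simp add: mult_FP N)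
    show "inv\<^bsub>FP\<^esub> x \<in> N"
      using xy wz by (simp add: inv_FP N winv_W acts_trivially_winv)
  qed
  moreover have "x \<otimes>\<^bsub>FP\<^esub> n \<otimes>\<^bsub>FP\<^esub> inv\<^bsub>FP\<^esub> x \<in> N" if xn: "x \<in> carrier FP" "n \<in> N" for x n
  proof -
    obtain a w where aw: "x = cls a" "n = cls w" "a \<in> W" "w \<in> W"
      using xn sub by (auto simp: carrier_FP)
    have "acts_trivially (a @ winv a)"
      using acts_trivially_rel[OF fp_rel.sym[OF winv_left[of "winv a"]] acts_trivially_Nil]
        aw winv_W[of a] by (simp add: winv_winv)
    then have "acts_trivially (a @ w @ winv a)"
      using acts_trivially_insert xn aw by (simp add: N winv_W)
    then show ?thesis using aw by (simp add: inv_FP mult_FP winv_W N)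
  qed
  ultimately have "N \<lhd> FP" by (auto simp: FP.normal_inv_iff)
  moreover have "relators \<subseteq> N"
  proof
    fix x assume "x \<in> relators"
    then obtain u v g h where x: "x = commutator FP (cls [(u, g)]) (cls [(v, h)])"
      and uv: "adj u v" and g: "g \<in> carrier (G u)" and h: "h \<in> carrier (G v)"
      unfolding relators_def by blast
    \<comment> \<open>The inverse of the reversed pair spells the inverse of \<open>g\<close>
      followed by that of \<open>h\<close>, so \<open>?c\<close> is the commutator. Swapping its
      first two letters makes it cancel.\<close>
    let ?c = "[(u, g), (v, h)] @ winv [(v, h), (u, g)]"
    have W: "[(u, g), (v, h)] \<in> W" "[(v, h), (u, g)] \<in> W" "[(u, g)] \<in> W" "[(v, h)] \<in> W"
      using adj_verts[OF uv] g h by auto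
    then have "x = cls ?c"
      using winv_W by (simp add: x commutator_def mult_FP inv_FP) (simp add: winv_def)
    moreover have "acts_trivially ?c"
    proof -
      have "shuffle (acts ?c x) x" if "reduced x" for x
      proof -
        have "shuffle (acts ?c x) (acts ([(v, h), (u, g)] @ winv [(v, h), (u, g)]) x)"
          using act_commute[OF uv] by simp
        also have "shuffle \<dots> (acts [] x)"
          using winv_left[of "winv [(v, h), (u, g)]"] W winv_W that
          by (intro fp_rel_acts) (simp_all add: winv_winv)
        finally show ?thesis by simp
      qed
      then show ?thesis by (simp add: acts_trivially_def)
    qed
    moreover have "?c \<in> W" using W winv_W[OF W(2)] by simp
    ultimately show "x \<in> N" by (simp add: N)
  qed
  ultimately have "K \<subseteq> N" unfolding gp_kernel_eq normal_closure_def by blast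
  then show ?thesis using assms N by blast
qed

section \<open>Words as elements of the graph product, and uniqueness of normal forms\<close>

definition elt :: "('v \<times> 'a) list \<Rightarrow> ('v \<times> 'a) list set set" where
  "elt w = K #>\<^bsub>FP\<^esub> cls w"

lemma carrier_P: "carrier P = elt ` W"
  by (auto simp: graph_product_def carrier_FactGroup carrier_FP elt_def)

lemma elt_append: "w \<in> W \<Longrightarrow> z \<in> W \<Longrightarrow> elt (w @ z) = elt w \<otimes>\<^bsub>P\<^esub> elt z"
  unfolding elt_def graph_product_def
  by (simp add: K.rcos_sum carrier_FP mult_FP[symmetric])

lemma elt_Nil: "elt [] = \<one>\<^bsub>P\<^esub>"
  unfolding elt_def graph_product_def
  by (simp add: one_FP[symmetric] FP.coset_mult_one K.subset)

text \<open>The word \<open>w' @ winv w\<close> represents an element of the kernel and so acts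
  trivially. Evaluating \<open>w' @ winv w @ w\<close> on the empty word in two ways compares
  \<open>w\<close> with \<open>w'\<close>.\<close>

lemma elt_eqD:
  assumes "w \<in> W" "w' \<in> W" "elt w = elt w'"
  shows "shuffle (acts w []) (acts w' [])"
proof -
  have c: "cls w \<in> carrier FP" "cls w' \<in> carrier FP" using assms by (auto simp: carrier_FP)
  have "cls w' \<in> elt w" using FP.rcos_self[OF c(2) K.subgroup_axioms] assms by (simp add: elt_def)
  then have "cls w' \<otimes>\<^bsub>FP\<^esub> inv\<^bsub>FP\<^esub> (cls w) \<in> K"
    using c K.rcos_module_imp[OF FP.group_axioms] by (simp add: elt_def)
  then have triv: "acts_trivially (w' @ winv w)"
    using assms by (intro K_acts_trivially) (simp_all add: inv_FP mult_FP winv_W)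
  have "shuffle (acts (w' @ winv w @ w) []) (acts (w' @ []) [])"
    using fp_rel_acts[OF winv_left[OF assms(1)], of "[]"] by (simp add: shuffle_acts)
  moreover have "shuffle (acts ((w' @ winv w) @ w) []) (acts w [])"
    using triv assms reduced_acts[of w "[]"] unfolding acts_trivially_def by simp
  ultimately show ?thesis by (simp) (meson shuffle_sym shuffle_trans)
qed

text \<open>The uniqueness half of the normal form theorem for graph products.\<close>

lemma elt_reduced_eqD: "reduced w \<Longrightarrow> reduced w' \<Longrightarrow> elt w = elt w' \<Longrightarrow> shuffle w w'"
  using elt_eqD[of w w'] by (simp add: reduced_in_W acts_reduced)

definition \<iota> :: "'v \<Rightarrow> 'a \<Rightarrow> ('v \<times> 'a) list set set" where
  "\<iota> u g = elt [(u, g)]"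

lemma vertex_subgroup_eq: "vertex_subgroup \<Gamma> G u = \<iota> u ` carrier (G u)"
  by (simp add: vertex_subgroup_def \<iota>_def elt_def cls_def fp_inclusion_def)

lemma elt_Cons: "(u, g) # w \<in> W \<Longrightarrow> elt ((u, g) # w) = \<iota> u g \<otimes>\<^bsub>P\<^esub> elt w"
  using elt_append[of "[(u, g)]" w] by (simp add: \<iota>_def)

lemma elt_closed: "w \<in> W \<Longrightarrow> elt w \<in> carrier P"
  by (simp add: carrier_P)

lemma \<iota>_closed: "u \<in> verts \<Gamma> \<Longrightarrow> g \<in> carrier (G u) \<Longrightarrow> \<iota> u g \<in> carrier P"
  by (simp add: \<iota>_def elt_closed)

lemma elt_rel: "(w, w') \<in> rel \<Longrightarrow> elt w = elt w'"
  using cls_eq_iff[of w w'] by (auto simp: elt_def dest: fp_rel_W)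

lemma \<iota>_one: "u \<in> verts \<Gamma> \<Longrightarrow> \<iota> u \<one>\<^bsub>G u\<^esub> = \<one>\<^bsub>P\<^esub>"
  using elt_rel[OF fp_rel.unit[of "[]" "verts \<Gamma>" G "[]" u]] by (simp add: \<iota>_def elt_Nil)

lemma \<iota>_mult:
  "u \<in> verts \<Gamma> \<Longrightarrow> g \<in> carrier (G u) \<Longrightarrow> h \<in> carrier (G u) \<Longrightarrow>
    \<iota> u (g \<otimes>\<^bsub>G u\<^esub> h) = \<iota> u g \<otimes>\<^bsub>P\<^esub> \<iota> u h"
  using elt_rel[OF fp_rel.mult[of "[]" "verts \<Gamma>" G "[]" u g h]]
    elt_append[of "[(u, g)]" "[(u, h)]"] by (simp add: \<iota>_def)

lemma \<iota>_inv:
  assumes "u \<in> verts \<Gamma>" "g \<in> carrier (G u)"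
  shows "\<iota> u (inv\<^bsub>G u\<^esub> g) = inv\<^bsub>P\<^esub> \<iota> u g"
  by (rule P.inv_equality[symmetric])
    (use assms \<iota>_mult[of u "inv\<^bsub>G u\<^esub> g" g] in \<open>auto simp: \<iota>_closed \<iota>_one\<close>)

text \<open>The corresponding relator lies in \<open>K\<close>, so its coset, which is the
  commutator of the two images, is trivial.\<close>

lemma \<iota>_commute:
  assumes "adj u v" "g \<in> carrier (G u)" "h \<in> carrier (G v)"
  shows "\<iota> u g \<otimes>\<^bsub>P\<^esub> \<iota> v h = \<iota> v h \<otimes>\<^bsub>P\<^esub> \<iota> u g"
proof -
  have W: "[(u, g)] \<in> W" "[(v, h)] \<in> W" using assms adj_verts[OF assms(1)] by auto
  then have c: "cls [(u, g)] \<in> carrier FP" "cls [(v, h)] \<in> carrier FP"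
    by (auto simp: carrier_FP)
  have cl: "\<iota> u g \<in> carrier P" "\<iota> v h \<in> carrier P" using assms adj_verts[OF assms(1)] by (auto simp: \<iota>_closed)
  \<comment> \<open>This and \<open>mult\<close> push the commutator of the free product through the
    quotient map.\<close>
  have inv: "K #>\<^bsub>FP\<^esub> inv\<^bsub>FP\<^esub> (cls w) = inv\<^bsub>P\<^esub> (elt w)" if "w \<in> W" for w
  proof (rule P.inv_equality[symmetric])
    have "(K #>\<^bsub>FP\<^esub> inv\<^bsub>FP\<^esub> cls w) = elt (winv w)" using that by (simp add: elt_def inv_FP)
    moreover have "elt (winv w) \<otimes>\<^bsub>P\<^esub> elt w = \<one>\<^bsub>P\<^esub>"
      using that elt_rel[OF winv_left[OF that]] by (simp add: elt_append[symmetric] winv_W elt_Nil)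
    ultimately show "(K #>\<^bsub>FP\<^esub> inv\<^bsub>FP\<^esub> cls w) \<otimes>\<^bsub>P\<^esub> elt w = \<one>\<^bsub>P\<^esub>" by simp
    show "elt w \<in> carrier P" "K #>\<^bsub>FP\<^esub> inv\<^bsub>FP\<^esub> cls w \<in> carrier P"
      using that by (auto simp: elt_closed inv_FP winv_W simp flip: elt_def)
  qed
  have mult: "K #>\<^bsub>FP\<^esub> (x \<otimes>\<^bsub>FP\<^esub> y) = (K #>\<^bsub>FP\<^esub> x) \<otimes>\<^bsub>P\<^esub> (K #>\<^bsub>FP\<^esub> y)"
    if "x \<in> carrier FP" "y \<in> carrier FP" for x y
    using that by (simp add: graph_product_def K.rcos_sum)
  have "commutator FP (cls [(u, g)]) (cls [(v, h)]) \<in> K"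
    using assms by (intro subsetD[OF relators_K]) (auto simp: relators_def)
  then have "K #>\<^bsub>FP\<^esub> commutator FP (cls [(u, g)]) (cls [(v, h)]) = \<one>\<^bsub>P\<^esub>"
    using K.rcos_const[OF FP.group_axioms] by (simp add: graph_product_def)
  then have "commutator P (\<iota> u g) (\<iota> v h) = \<one>\<^bsub>P\<^esub>"
    using c W by (simp add: commutator_def mult inv \<iota>_def elt_def[symmetric])
  then show ?thesis
    using cl unfolding commutator_def
    by (metis P.inv_closed P.m_closed P.inv_solve_right' P.l_one P.m_assoc)
qed

section \<open>Parabolic subgroups\<close>

lemma elt_shuffle: "shuffle w w' \<Longrightarrow> w \<in> W \<Longrightarrow> elt w = elt w' \<and> w' \<in> W"
proof (induction rule: shuffle.induct)
  case (shuffle_Cons w w' a)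
  then show ?case by (cases a) (auto simp: elt_Cons)
next
  case (shuffle_swap u v g h w)
  then have "\<iota> u g \<otimes>\<^bsub>P\<^esub> (\<iota> v h \<otimes>\<^bsub>P\<^esub> elt w) = \<iota> v h \<otimes>\<^bsub>P\<^esub> (\<iota> u g \<otimes>\<^bsub>P\<^esub> elt w)"
    using \<iota>_commute[of u v g h] by (simp add: \<iota>_closed elt_closed flip: P.m_assoc)
  then show ?case using shuffle_swap by (simp add: elt_Cons)
qed auto

lemma elt_head_tail:
  assumes "reduced w" "u \<in> verts \<Gamma>"
  shows "elt w = \<iota> u (head u w) \<otimes>\<^bsub>P\<^esub> elt (tail u w)"
proof (cases "head u w = \<one>\<^bsub>G u\<^esub>")
  case True
  then show ?thesis using assms
    by (simp add: tail_trivial \<iota>_one elt_closed reduced_in_W)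
next
  case False
  then have "elt ((u, head u w) # tail u w) = elt w"
    using elt_shuffle[OF shuffle_head_tail] assms
    by (simp add: reduced_in_W head_closed tail_in_W)
  then show ?thesis using assms
    by (simp add: elt_Cons reduced_in_W head_closed tail_in_W)
qed

lemma elt_act:
  assumes "reduced w" "u \<in> verts \<Gamma>" "g \<in> carrier (G u)"
  shows "elt (act (u, g) w) = \<iota> u g \<otimes>\<^bsub>P\<^esub> elt w"
proof -
  let ?k = "g \<otimes>\<^bsub>G u\<^esub> head u w"
  have k: "head u w \<in> carrier (G u)" "tail u w \<in> W"
    using assms by (simp_all add: reduced_in_W head_closed tail_in_W)
  have "elt (act (u, g) w) = \<iota> u ?k \<otimes>\<^bsub>P\<^esub> elt (tail u w)"
    using assms k by (auto simp: ncons_def \<iota>_one elt_Cons elt_closed)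
  then show ?thesis
    using assms k elt_head_tail[of w u] by (simp add: \<iota>_mult P.m_assoc \<iota>_closed elt_closed)
qed

text \<open>The existence half of the normal form theorem: \<open>acts w []\<close> is a reduced
  word for the same element.\<close>

lemma elt_acts: "w \<in> W \<Longrightarrow> elt (acts w []) = elt w"
proof (induction w)
  case (Cons a w)
  then show ?case
    by (cases a) (simp add: elt_act reduced_acts elt_Cons del: act.simps)
qed simp

text \<open>The parabolic subgroup generated by the vertex-groups indexed by
  \<open>\<Lambda>\<close>. The set \<open>\<Lambda>\<close> need not consist of vertices, so
  \<open>UNIV\<close> gives the whole group.\<close>

definition parab :: "'v set \<Rightarrow> ('v \<times> 'a) list set set set" where
  "parab \<Lambda> = elt ` {w \<in> W. fst ` set w \<subseteq> \<Lambda>}"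

definition nbhd :: "'v \<Rightarrow> 'v set" where
  "nbhd u = insert u {v. adj u v}"

lemma parab_closed: "x \<in> parab \<Lambda> \<Longrightarrow> x \<in> carrier P"
  by (auto simp: parab_def elt_closed)

lemma parab_mult: "x \<in> parab \<Lambda> \<Longrightarrow> y \<in> parab \<Lambda> \<Longrightarrow> x \<otimes>\<^bsub>P\<^esub> y \<in> parab \<Lambda>"
  unfolding parab_def
proof (elim imageE)
  fix w z assume "x = elt w" "y = elt z" "w \<in> {w \<in> W. fst ` set w \<subseteq> \<Lambda>}" "z \<in> {w \<in> W. fst ` set w \<subseteq> \<Lambda>}"
  then show "x \<otimes>\<^bsub>P\<^esub> y \<in> elt ` {w \<in> W. fst ` set w \<subseteq> \<Lambda>}"
    by (intro image_eqI[of _ _ "w @ z"]) (auto simp: elt_append)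
qed

lemma parab_mono: "\<Lambda> \<subseteq> \<Lambda>' \<Longrightarrow> parab \<Lambda> \<subseteq> parab \<Lambda>'"
  unfolding parab_def by (intro image_mono) auto

lemma \<iota>_parab: "u \<in> verts \<Gamma> \<Longrightarrow> g \<in> carrier (G u) \<Longrightarrow> u \<in> \<Lambda> \<Longrightarrow> \<iota> u g \<in> parab \<Lambda>"
  by (auto simp: parab_def \<iota>_def)

lemma one_parab: "\<one>\<^bsub>P\<^esub> \<in> parab \<Lambda>"
  using elt_Nil by (auto simp: parab_def intro!: image_eqI[of _ _ "[]"])

text \<open>Passing to a normal form introduces no new label.\<close>

lemma parab_reduced:
  assumes "x \<in> parab \<Lambda>"
  obtains w where "reduced w" "fst ` set w \<subseteq> \<Lambda>" "x = elt w"
proof -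
  obtain w where w: "w \<in> W" "fst ` set w \<subseteq> \<Lambda>" "x = elt w"
    using assms by (auto simp: parab_def)
  then have "fst ` set (acts w []) \<subseteq> \<Lambda>" using labels_acts by blast
  then show ?thesis using that[of "acts w []"] w by (simp add: reduced_acts elt_acts)
qed

lemma carrier_parab: "carrier P = parab UNIV"
  by (simp add: parab_def carrier_P)

lemma cancel_inv:
  assumes "x \<in> carrier P" "y \<in> carrier P"
  shows "inv\<^bsub>P\<^esub> x \<otimes>\<^bsub>P\<^esub> (x \<otimes>\<^bsub>P\<^esub> y) = y" "x \<otimes>\<^bsub>P\<^esub> (inv\<^bsub>P\<^esub> x \<otimes>\<^bsub>P\<^esub> y) = y"
  using assms by (simp_all flip: P.m_assoc)

lemmas P_simps = P.m_assoc P.inv_mult_group cancel_inv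

text \<open>Letters of \<open>w\<close> are stripped off: those with label in
  \<open>\<Lambda>\<close> from the left into the first factor, those labelled \<open>v\<close> from
  the right into the second. When nothing can be stripped, comparing normal forms shows that
  \<open>w\<close> commutes with the \<open>v\<close>-letter.\<close>

lemma conj_in_parab_reduced:
  assumes "reduced w" "p \<in> parab \<Lambda>" "v \<in> verts \<Gamma>" "t \<in> carrier (G v)" "t \<noteq> \<one>\<^bsub>G v\<^esub>"
    and "p \<otimes>\<^bsub>P\<^esub> elt w = elt w \<otimes>\<^bsub>P\<^esub> \<iota> v t"
  shows "v \<in> \<Lambda> \<and> (\<exists>a\<in>parab \<Lambda>. \<exists>b\<in>parab (nbhd v). elt w = a \<otimes>\<^bsub>P\<^esub> b)"
  using assms
proof (induction "length w" arbitrary: w p t rule: less_induct)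
  case less
  have wW: "w \<in> W" using less.prems by (simp add: reduced_in_W)
  have cl: "p \<in> carrier P" "elt w \<in> carrier P" "\<iota> v t \<in> carrier P"
    using less.prems wW by (simp_all add: parab_closed elt_closed \<iota>_closed)
  interpret Gv: group "G v" using less.prems by (intro vertex_group)
  consider (left) u where "u \<in> \<Lambda>" "u \<in> verts \<Gamma>" "head u w \<noteq> \<one>\<^bsub>G u\<^esub>"
    | (right) w' k where "shuffle w (w' @ [(v, k)])"
    | (none) "reduced (w @ [(v, t)])" "\<And>u. u \<in> \<Lambda> \<Longrightarrow> u \<in> verts \<Gamma> \<Longrightarrow> head u w = \<one>\<^bsub>G u\<^esub>"
    using reduced_snoc less.prems by blast
  then show ?case
  proof cases
    case left
    let ?k = "head u w" and ?y = "elt (tail u w)"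
    have k: "?k \<in> carrier (G u)" using left wW by (simp add: head_closed)
    have c: "\<iota> u ?k \<in> carrier P" "?y \<in> carrier P"
      using k left wW by (simp_all add: \<iota>_closed elt_closed tail_in_W)
    have w: "elt w = \<iota> u ?k \<otimes>\<^bsub>P\<^esub> ?y" using left less.prems by (intro elt_head_tail)
    \<comment> \<open>Stripping a left letter conjugates \<open>p\<close> by an element of the
      parabolic subgroup, so the new \<open>p\<close> stays there.\<close>
    let ?p = "inv\<^bsub>P\<^esub> \<iota> u ?k \<otimes>\<^bsub>P\<^esub> p \<otimes>\<^bsub>P\<^esub> \<iota> u ?k"
    have "?p \<in> parab \<Lambda>"
      using k left less.prems by (intro parab_mult) (simp_all add: \<iota>_parab \<iota>_inv[symmetric])
    moreover have "?p \<otimes>\<^bsub>P\<^esub> ?y = ?y \<otimes>\<^bsub>P\<^esub> \<iota> v t"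
      using less.prems(6) c cl by (simp add: w P_simps)
    moreover have "length (tail u w) < length w" using length_tail[OF left(3)] by simp
    ultimately have IH: "v \<in> \<Lambda> \<and> (\<exists>a\<in>parab \<Lambda>. \<exists>b\<in>parab (nbhd v). ?y = a \<otimes>\<^bsub>P\<^esub> b)"
      using less.hyps less.prems by (simp add: reduced_tail)
    then obtain a b where ab: "a \<in> parab \<Lambda>" "b \<in> parab (nbhd v)" "?y = a \<otimes>\<^bsub>P\<^esub> b" by blast
    have "\<iota> u ?k \<otimes>\<^bsub>P\<^esub> a \<in> parab \<Lambda>" using ab k left by (simp add: parab_mult \<iota>_parab)
    moreover have "elt w = (\<iota> u ?k \<otimes>\<^bsub>P\<^esub> a) \<otimes>\<^bsub>P\<^esub> b"
      using ab c by (simp add: w P.m_assoc parab_closed)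
    ultimately show ?thesis using IH ab by blast
  next
    case right
    have r: "reduced (w' @ [(v, k)])" using right less.prems shuffle_reduced by blast
    then have k: "k \<in> carrier (G v)" and w'W: "w' \<in> W" using reduced_in_W by fastforce+
    \<comment> \<open>Stripping a right letter \<open>k\<close> replaces \<open>t\<close> by its
      conjugate in \<open>G v\<close>, which is still non-trivial.\<close>
    let ?y = "elt w'" and ?t = "k \<otimes>\<^bsub>G v\<^esub> t \<otimes>\<^bsub>G v\<^esub> inv\<^bsub>G v\<^esub> k"
    have c: "\<iota> v k \<in> carrier P" "?y \<in> carrier P"
      using k less.prems w'W by (simp_all add: \<iota>_closed elt_closed)
    have w: "elt w = ?y \<otimes>\<^bsub>P\<^esub> \<iota> v k"
      using elt_shuffle[OF right wW] elt_append[of w' "[(v, k)]"] w'W k less.prems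
      by (simp add: \<iota>_def)
    have "\<iota> v ?t = \<iota> v k \<otimes>\<^bsub>P\<^esub> \<iota> v t \<otimes>\<^bsub>P\<^esub> inv\<^bsub>P\<^esub> \<iota> v k"
      using k less.prems by (simp add: \<iota>_mult \<iota>_inv)
    moreover have "p \<otimes>\<^bsub>P\<^esub> ?y \<otimes>\<^bsub>P\<^esub> \<iota> v k \<otimes>\<^bsub>P\<^esub> inv\<^bsub>P\<^esub> \<iota> v k
        = ?y \<otimes>\<^bsub>P\<^esub> \<iota> v k \<otimes>\<^bsub>P\<^esub> \<iota> v t \<otimes>\<^bsub>P\<^esub> inv\<^bsub>P\<^esub> \<iota> v k"
      using less.prems(6) c cl by (simp add: w P.m_assoc[symmetric])
    ultimately have "p \<otimes>\<^bsub>P\<^esub> ?y = ?y \<otimes>\<^bsub>P\<^esub> \<iota> v ?t"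
      using c cl by (simp add: P.m_assoc)
    moreover have "?t \<noteq> \<one>\<^bsub>G v\<^esub>"
    proof
      assume "?t = \<one>\<^bsub>G v\<^esub>"
      then have "k \<otimes>\<^bsub>G v\<^esub> t = k" using k less.prems
        by (metis Gv.inv_closed Gv.inv_equality Gv.inv_inv Gv.m_closed)
      then show False using k less.prems by simp
    qed
    moreover have "length w' < length w" using shuffle_set[OF right] by simp
    ultimately have IH: "v \<in> \<Lambda> \<and> (\<exists>a\<in>parab \<Lambda>. \<exists>b\<in>parab (nbhd v). ?y = a \<otimes>\<^bsub>P\<^esub> b)"
      using less.hyps[of w' p ?t] less.prems reduced_appendD[OF r] k by simp
    then obtain a b where ab: "a \<in> parab \<Lambda>" "b \<in> parab (nbhd v)" "?y = a \<otimes>\<^bsub>P\<^esub> b" by blast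
    have "b \<otimes>\<^bsub>P\<^esub> \<iota> v k \<in> parab (nbhd v)"
      using ab k less.prems by (simp add: parab_mult \<iota>_parab nbhd_def)
    moreover have "elt w = a \<otimes>\<^bsub>P\<^esub> (b \<otimes>\<^bsub>P\<^esub> \<iota> v k)"
      using ab c by (simp add: w P.m_assoc parab_closed)
    ultimately show ?thesis using IH ab by blast
  next
    case none
    obtain z where z: "reduced z" "fst ` set z \<subseteq> \<Lambda>" "p = elt z"
      using less.prems by (blast elim: parab_reduced)
    have zW: "z \<in> W" using z by (simp add: reduced_in_W)
    have lab: "x \<in> \<Lambda> \<and> x \<in> verts \<Gamma>" if "(x, k) \<in> set z" for x k
      using that z zW by (fastforce simp: fp_words_def)
    \<comment> \<open>No letter of \<open>w\<close> with label in \<open>\<Lambda>\<close> can reach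
      its front, so nothing merges at the junction.\<close>
    have "reduced (z @ w)"
      using z less.prems none lab by (intro reduced_append) auto
    moreover have "elt (z @ w) = elt (w @ [(v, t)])"
      using less.prems(6) z zW wW less.prems by (simp add: elt_append \<iota>_def)
    ultimately have sh: "shuffle (z @ w) (w @ [(v, t)])"
      using none by (intro elt_reduced_eqD)
    \<comment> \<open>Equal lengths force \<open>z\<close> to be a single letter; counting
      occurrences then identifies it with \<open>(v, t)\<close>.\<close>
    then obtain x k where "z = [(x, k)]" using shuffle_set[OF sh] by (cases z) auto
    moreover from this have "(x, k) = (v, t)"
      using shuffle_count[OF sh, of "(x, k)"] by (simp split: if_splits)
    ultimately have "z = [(v, t)]" by simp
    then have v: "v \<in> \<Lambda>" "head v (w @ [(v, t)]) \<noteq> \<one>\<^bsub>G v\<^esub>"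
      using shuffle_head[OF sh, of v] z less.prems by auto
    \<comment> \<open>As \<open>v\<close> lies in \<open>\<Lambda>\<close>, the value
      \<open>head v w\<close> is trivial; the \<open>v\<close>-letter that surfaces is thus the last
      one, which must pass all of \<open>w\<close>.\<close>
    then have "\<forall>(x, k) \<in> set w. adj v x"
      using none(2) less.prems(3) by (auto simp: head_append split: if_splits)
    then have "elt w \<in> parab (nbhd v)" using wW by (fastforce simp: parab_def nbhd_def)
    then show ?thesis using v one_parab cl by (intro conjI bexI[of _ "\<one>\<^bsub>P\<^esub>"] bexI[of _ "elt w"]) auto
  qed
qed

section \<open>Syllables\<close>

text \<open>Non-trivial elements of a vertex-group, that is, the labels of oriented edges of the
  Cayley graph.\<close>

definition syl :: "'v \<Rightarrow> ('v \<times> 'a) list set set \<Rightarrow> bool" where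
  "syl u a \<longleftrightarrow> u \<in> verts \<Gamma> \<and> (\<exists>s\<in>carrier (G u). s \<noteq> \<one>\<^bsub>G u\<^esub> \<and> a = \<iota> u s)"

text \<open>The equation says that the conjugate of \<open>t\<close> by \<open>k\<close> is
  \<open>p\<close>; the conclusion locates \<open>k\<close> in a product of two parabolic
  subgroups.\<close>

lemma conj_in_parab:
  assumes "k \<in> carrier P" "p \<in> parab \<Lambda>" "syl v t" "p \<otimes>\<^bsub>P\<^esub> k = k \<otimes>\<^bsub>P\<^esub> t"
  obtains a b where "v \<in> \<Lambda>" "a \<in> parab \<Lambda>" "b \<in> parab (nbhd v)" "k = a \<otimes>\<^bsub>P\<^esub> b"
proof -
  obtain w where "reduced w" "k = elt w"
    using assms(1) unfolding carrier_parab by (blast elim: parab_reduced)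
  then show ?thesis
    using conj_in_parab_reduced[of w p \<Lambda> v] assms that unfolding syl_def by blast
qed

lemma syl_verts: "syl u a \<Longrightarrow> u \<in> verts \<Gamma>"
  by (simp add: syl_def)

lemma syl_closed: "syl u a \<Longrightarrow> a \<in> carrier P"
  by (auto simp: syl_def \<iota>_closed)

lemma syl_exists: "u \<in> verts \<Gamma> \<Longrightarrow> \<exists>a. syl u a"
  using nontrivial[of u] vertex_closed(1)[of u] by (auto simp: syl_def)

lemma syl_not_one: "syl u a \<Longrightarrow> a \<noteq> \<one>\<^bsub>P\<^esub>"
proof
  assume "syl u a" "a = \<one>\<^bsub>P\<^esub>"
  then obtain s where "reduced [(u, s)]" "elt [(u, s)] = elt []"
    by (auto simp: syl_def \<iota>_def elt_Nil)
  then have "shuffle [(u, s)] []" by (intro elt_reduced_eqD) simp_all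
  then show False using shuffle_set[of "[(u, s)]" "[]"] by simp
qed

lemma syl_label_unique: "syl u a \<Longrightarrow> syl v a \<Longrightarrow> u = v"
proof -
  assume "syl u a" "syl v a"
  then obtain s t where "reduced [(u, s)]" "reduced [(v, t)]" "elt [(u, s)] = elt [(v, t)]"
    by (auto simp: syl_def \<iota>_def)
  then have "shuffle [(u, s)] [(v, t)]" by (intro elt_reduced_eqD)
  then show "u = v" using shuffle_set[of "[(u, s)]" "[(v, t)]"] by simp
qed

lemma vertex_subgroup_syl:
  "u \<in> verts \<Gamma> \<Longrightarrow> vertex_subgroup \<Gamma> G u = insert \<one>\<^bsub>P\<^esub> {a. syl u a}"
  using \<iota>_one[of u] by (force simp: vertex_subgroup_eq syl_def)

lemma vertex_subgroup_subgroup: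
  assumes "u \<in> verts \<Gamma>"
  shows "subgroup (vertex_subgroup \<Gamma> G u) P"
proof
  show "vertex_subgroup \<Gamma> G u \<subseteq> carrier P"
    using assms by (auto simp: vertex_subgroup_eq \<iota>_closed)
  show "\<one>\<^bsub>P\<^esub> \<in> vertex_subgroup \<Gamma> G u" using assms by (simp add: vertex_subgroup_syl)
  show "x \<otimes>\<^bsub>P\<^esub> y \<in> vertex_subgroup \<Gamma> G u"
    if "x \<in> vertex_subgroup \<Gamma> G u" "y \<in> vertex_subgroup \<Gamma> G u" for x y
    using assms that by (auto simp: vertex_subgroup_eq simp flip: \<iota>_mult)
  show "inv\<^bsub>P\<^esub> x \<in> vertex_subgroup \<Gamma> G u" if "x \<in> vertex_subgroup \<Gamma> G u" for x
    using assms that by (auto simp: vertex_subgroup_eq simp flip: \<iota>_inv)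
qed

lemma syl_inv: "syl u a \<Longrightarrow> syl u (inv\<^bsub>P\<^esub> a)"
proof -
  assume a: "syl u a"
  then have "inv\<^bsub>P\<^esub> a \<in> vertex_subgroup \<Gamma> G u"
    using subgroup.m_inv_closed[OF vertex_subgroup_subgroup[of u], of a]
    by (simp add: vertex_subgroup_syl syl_verts)
  moreover have "inv\<^bsub>P\<^esub> a \<noteq> \<one>\<^bsub>P\<^esub>" using a by (simp add: syl_closed syl_not_one)
  ultimately show ?thesis using a by (simp add: vertex_subgroup_syl syl_verts)
qed

lemma syl_mult:
  assumes "syl u a" "syl u b"
  shows "a \<otimes>\<^bsub>P\<^esub> b = \<one>\<^bsub>P\<^esub> \<or> syl u (a \<otimes>\<^bsub>P\<^esub> b)"
proof -
  have "a \<otimes>\<^bsub>P\<^esub> b \<in> vertex_subgroup \<Gamma> G u"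
    using assms subgroup.m_closed[OF vertex_subgroup_subgroup[of u], of a b]
    by (simp add: vertex_subgroup_syl syl_verts)
  then show ?thesis using assms by (simp add: vertex_subgroup_syl syl_verts)
qed

lemma syl_mult_reduced:
  assumes "syl u a" "syl v b" "u \<noteq> v"
  obtains s t where "reduced [(u, s), (v, t)]" "a \<otimes>\<^bsub>P\<^esub> b = elt [(u, s), (v, t)]"
    "a = \<iota> u s" "b = \<iota> v t"
proof -
  obtain s where s: "u \<in> verts \<Gamma>" "s \<in> carrier (G u)" "s \<noteq> \<one>\<^bsub>G u\<^esub>" "a = \<iota> u s"
    using assms(1) unfolding syl_def by blast
  obtain t where t: "v \<in> verts \<Gamma>" "t \<in> carrier (G v)" "t \<noteq> \<one>\<^bsub>G v\<^esub>" "b = \<iota> v t"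
    using assms(2) unfolding syl_def by blast
  show ?thesis
  proof (rule that)
    show "reduced [(u, s), (v, t)]" using s(1-3) t(1-3) assms(3) by simp
    show "a \<otimes>\<^bsub>P\<^esub> b = elt [(u, s), (v, t)]"
      using s(1,2) t(1,2) by (simp add: s(4) t(4) elt_Cons elt_Nil \<iota>_closed)
  qed (fact s t)+
qed

text \<open>With distinct labels the product would have a reduced word of length two, which cannot
  be a shuffle of one letter.\<close>

lemma syl_mult_same: "syl u a \<Longrightarrow> syl v b \<Longrightarrow> syl w (a \<otimes>\<^bsub>P\<^esub> b) \<Longrightarrow> u = v \<and> v = w"
proof -
  assume *: "syl u a" "syl v b" "syl w (a \<otimes>\<^bsub>P\<^esub> b)"
  have "u = v"
  proof (rule ccontr)
    assume "u \<noteq> v"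
    then obtain s t where "reduced [(u, s), (v, t)]" "a \<otimes>\<^bsub>P\<^esub> b = elt [(u, s), (v, t)]"
      by (rule syl_mult_reduced[OF *(1,2)])
    moreover obtain r where r: "w \<in> verts \<Gamma>" "r \<in> carrier (G w)" "r \<noteq> \<one>\<^bsub>G w\<^esub>" "a \<otimes>\<^bsub>P\<^esub> b = \<iota> w r"
      using *(3) unfolding syl_def by blast
    moreover have "reduced [(w, r)]" using r(1-3) by simp
    moreover have "elt [(w, r)] = a \<otimes>\<^bsub>P\<^esub> b" by (simp only: r(4) \<iota>_def)
    ultimately have "shuffle [(u, s), (v, t)] [(w, r)]"
      by (intro elt_reduced_eqD) (assumption, assumption, metis)
    then show False using shuffle_set[of "[(u, s), (v, t)]" "[(w, r)]"] by simp
  qed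
  then have s: "syl u (a \<otimes>\<^bsub>P\<^esub> b)"
    using syl_mult[of u a b] *(1,2) syl_not_one[OF *(3)] by simp
  then show ?thesis using syl_label_unique[OF s *(3)] \<open>u = v\<close> by simp
qed

lemma syl_mult_not_one:
  assumes "syl u a" "syl v b" "u \<noteq> v"
  shows "a \<otimes>\<^bsub>P\<^esub> b \<noteq> \<one>\<^bsub>P\<^esub>"
proof
  assume "a \<otimes>\<^bsub>P\<^esub> b = \<one>\<^bsub>P\<^esub>"
  then have "inv\<^bsub>P\<^esub> b = a" using assms by (intro P.inv_equality) (simp_all add: syl_closed)
  then show False using assms syl_inv[OF assms(2)] syl_label_unique by blast
qed

lemma syl_commute: "adj u v \<Longrightarrow> syl u a \<Longrightarrow> syl v b \<Longrightarrow> a \<otimes>\<^bsub>P\<^esub> b = b \<otimes>\<^bsub>P\<^esub> a"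
  unfolding syl_def by (elim conjE bexE) (hypsubst, rule \<iota>_commute)

text \<open>Both sides have reduced words of length two that are shuffles of each other; since the
  first syllables differ, the shuffle must exchange the letters, and this requires adjacent
  labels.\<close>

lemma syl_square:
  assumes "syl u a" "syl v b" "syl v' b'" "syl u' a'" "u \<noteq> v"
    and eq: "a \<otimes>\<^bsub>P\<^esub> b = b' \<otimes>\<^bsub>P\<^esub> a'" and "a \<noteq> b'"
  shows "u' = u \<and> v' = v \<and> adj u v \<and> b' = b"
proof -
  obtain s t where st: "reduced [(u, s), (v, t)]" "a \<otimes>\<^bsub>P\<^esub> b = elt [(u, s), (v, t)]"
    "a = \<iota> u s" "b = \<iota> v t"
    by (rule syl_mult_reduced[OF assms(1,2,5)])
  \<comment> \<open>With equal labels the right-hand side would be trivial or a single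
    syllable.\<close>
  have "v' \<noteq> u'"
  proof
    assume "v' = u'"
    then have "a \<otimes>\<^bsub>P\<^esub> b = \<one>\<^bsub>P\<^esub> \<or> syl u' (a \<otimes>\<^bsub>P\<^esub> b)"
      using syl_mult[of u' b' a'] assms(3,4) eq by simp
    then show False
      using syl_mult_not_one[OF assms(1,2,5)] syl_mult_same[OF assms(1,2)] assms(5) by blast
  qed
  then obtain s' t' where st': "reduced [(v', t'), (u', s')]" "b' \<otimes>\<^bsub>P\<^esub> a' = elt [(v', t'), (u', s')]"
    "b' = \<iota> v' t'" "a' = \<iota> u' s'"
    by (rule syl_mult_reduced[OF assms(3,4)])
  have sh: "shuffle [(u, s), (v, t)] [(v', t'), (u', s')]"
    using st st' eq by (intro elt_reduced_eqD) auto
  then have "{(u, s), (v, t)} = {(v', t'), (u', s')}" using shuffle_set[OF sh] by simp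
  moreover have "(u, s) \<noteq> (v', t')" using assms(7) st(3) st'(3) by blast
  ultimately have "(u, s) = (u', s')" "(v, t) = (v', t')" unfolding doubleton_eq_iff by metis+
  moreover from this have "adj u v"
    using shuffle_head[OF sh, of u] st(1) assms(5) by (auto split: if_splits)
  ultimately show ?thesis using st st' by simp
qed

section \<open>Edges and conjugates\<close>

text \<open>The element read along a path from \<open>x\<close> to \<open>y\<close>. Edges are right
  multiplications, so it is invariant under left translation.\<close>

definition diff :: "('v \<times> 'a) list set set \<Rightarrow> ('v \<times> 'a) list set set \<Rightarrow> ('v \<times> 'a) list set set" where
  "diff x y = inv\<^bsub>P\<^esub> x \<otimes>\<^bsub>P\<^esub> y"

definition edge :: "('v \<times> 'a) list set set \<Rightarrow> 'v \<Rightarrow> ('v \<times> 'a) list set set \<Rightarrow> bool" where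
  "edge x u y \<longleftrightarrow> x \<in> carrier P \<and> y \<in> carrier P \<and> syl u (diff x y)"

lemma diff_mult: "x \<in> carrier P \<Longrightarrow> y \<in> carrier P \<Longrightarrow> z \<in> carrier P \<Longrightarrow>
    diff x y \<otimes>\<^bsub>P\<^esub> diff y z = diff x z"
  by (simp add: diff_def P_simps)

lemma diff_eq_iff: "x \<in> carrier P \<Longrightarrow> y \<in> carrier P \<Longrightarrow> a \<in> carrier P \<Longrightarrow>
    diff x y = a \<longleftrightarrow> y = x \<otimes>\<^bsub>P\<^esub> a"
  by (auto simp: diff_def cancel_inv)

lemma diff_inv: "x \<in> carrier P \<Longrightarrow> y \<in> carrier P \<Longrightarrow> inv\<^bsub>P\<^esub> (diff x y) = diff y x"
  by (simp add: diff_def P.inv_mult_group)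

lemma edge_sym: "edge x u y \<longleftrightarrow> edge y u x"
  unfolding edge_def using syl_inv diff_inv by metis

lemma edge_mult: "x \<in> carrier P \<Longrightarrow> syl u a \<Longrightarrow> edge x u (x \<otimes>\<^bsub>P\<^esub> a)"
  by (simp add: edge_def diff_def syl_closed cancel_inv)

lemma edge_translate:
  "g \<in> carrier P \<Longrightarrow> x \<in> carrier P \<Longrightarrow> y \<in> carrier P \<Longrightarrow>
    edge (g \<otimes>\<^bsub>P\<^esub> x) u (g \<otimes>\<^bsub>P\<^esub> y) \<longleftrightarrow> edge x u y"
  by (simp add: edge_def diff_def P_simps)

abbreviation Q where "Q \<equiv> QM \<Gamma> G"

lemma generators:
  "a \<in> (\<Union>u\<in>verts \<Gamma>. vertex_subgroup \<Gamma> G u) - {\<one>\<^bsub>P\<^esub>} \<longleftrightarrow> (\<exists>u. syl u a)"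
proof -
  have "(\<exists>u\<in>verts \<Gamma>. a \<in> vertex_subgroup \<Gamma> G u) \<longleftrightarrow> (\<exists>u\<in>verts \<Gamma>. a = \<one>\<^bsub>P\<^esub> \<or> syl u a)"
    by (simp add: vertex_subgroup_syl)
  then show ?thesis using syl_verts syl_not_one by blast
qed

lemma edges_Q: "e \<in> edges Q \<longleftrightarrow> (\<exists>x u y. e = {x, y} \<and> edge x u y)"
proof -
  have "e \<in> edges Q \<longleftrightarrow> (\<exists>x a. e = {x, x \<otimes>\<^bsub>P\<^esub> a} \<and> x \<in> carrier P \<and> (\<exists>u. syl u a))"
    unfolding QM_def cayley_graph_def by (simp only: ugraph.simps generators mem_Collect_eq)
  also have "\<dots> \<longleftrightarrow> (\<exists>x u y. e = {x, y} \<and> edge x u y)"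
    using edge_mult by (metis cancel_inv(2) diff_def edge_def P.inv_closed)
  finally show ?thesis .
qed

lemma edges_Q_pair: "{x, y} \<in> edges Q \<longleftrightarrow> (\<exists>u. edge x u y)"
  unfolding edges_Q using edge_sym by (metis doubleton_eq_iff)

lemma edge_triangle: "edge x u y \<Longrightarrow> edge y v z \<Longrightarrow> edge x w z \<Longrightarrow> u = v \<and> v = w"
  unfolding edge_def using syl_mult_same diff_mult by metis

lemma edge_label_unique: "edge x u y \<Longrightarrow> edge x v y \<Longrightarrow> u = v"
  unfolding edge_def using syl_label_unique by blast

text \<open>The two paths from \<open>a\<close> to \<open>c\<close> factor \<open>diff a c\<close>
  in two ways, to which \<open>syl_square\<close> applies.\<close>

lemma is_square_edges:
  assumes "is_square Q a b c d"
  obtains u v where "edge a u b" "edge b v c" "edge d u c" "edge a v d" "adj u v"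
    "diff a d = diff b c"
proof -
  obtain u v u' v' where e: "edge a u b" "edge b v c" "edge d u' c" "edge a v' d"
    using assms unfolding is_square_def edges_Q_pair using edge_sym by blast
  have cl: "a \<in> carrier P" "b \<in> carrier P" "c \<in> carrier P" "d \<in> carrier P"
    using e by (auto simp: edge_def)
  have ne: "a \<noteq> c" "b \<noteq> d" "\<not> edge a w c" for w
    using assms by (auto simp: is_square_def edges_Q_pair)
  \<comment> \<open>Equal labels would make \<open>a\<close> and \<open>c\<close> equal or adjacent,
    but the square is induced.\<close>
  have "u \<noteq> v"
  proof
    assume "u = v"
    then have "diff a c = \<one>\<^bsub>P\<^esub> \<or> syl u (diff a c)"
      using syl_mult[of u "diff a b" "diff b c"] e cl by (simp add: edge_def diff_mult)
    then show False using ne cl by (simp add: edge_def diff_eq_iff)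
  qed
  moreover have "diff a b \<noteq> diff a d" using ne cl by (auto simp: diff_def)
  ultimately have "u' = u \<and> v' = v \<and> adj u v \<and> diff a d = diff b c"
    using e cl by (intro syl_square[of u "diff a b" v _ v' _ u' "diff d c"]) (simp_all add: edge_def diff_mult)
  then show ?thesis using e that by blast
qed

text \<open>The converse of \<open>is_square_edges\<close>. The diagonals are absent because a
  product of two syllables with distinct labels is not a syllable.\<close>

lemma is_square_syl:
  assumes "g \<in> carrier P" "adj u v" "syl u a" "syl v b"
  shows "is_square Q g (g \<otimes>\<^bsub>P\<^esub> a) (g \<otimes>\<^bsub>P\<^esub> a \<otimes>\<^bsub>P\<^esub> b) (g \<otimes>\<^bsub>P\<^esub> b)"
proof -
  have cl: "a \<in> carrier P" "b \<in> carrier P" using assms by (simp_all add: syl_closed)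
  have uv: "u \<noteq> v" using assms by auto
  have com: "a \<otimes>\<^bsub>P\<^esub> b = b \<otimes>\<^bsub>P\<^esub> a" using assms syl_commute by blast
  have n1: "\<not> edge g w (g \<otimes>\<^bsub>P\<^esub> a \<otimes>\<^bsub>P\<^esub> b)" for w
    using assms cl uv syl_mult_same[of u a v b w] by (auto simp: edge_def diff_def P_simps)
  have n2: "\<not> edge (g \<otimes>\<^bsub>P\<^esub> a) w (g \<otimes>\<^bsub>P\<^esub> b)" for w
    using assms cl uv syl_mult_same[of u "inv\<^bsub>P\<^esub> a" v b w] syl_inv
    by (auto simp: edge_def diff_def P_simps)
  have e1: "edge g u (g \<otimes>\<^bsub>P\<^esub> a)" using assms by (simp add: edge_mult)
  have e2: "edge (g \<otimes>\<^bsub>P\<^esub> a) v (g \<otimes>\<^bsub>P\<^esub> a \<otimes>\<^bsub>P\<^esub> b)" using assms cl by (simp add: edge_mult)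
  have e3: "edge (g \<otimes>\<^bsub>P\<^esub> a \<otimes>\<^bsub>P\<^esub> b) u (g \<otimes>\<^bsub>P\<^esub> b)"
    using edge_mult[of "g \<otimes>\<^bsub>P\<^esub> b" u a] assms cl com by (simp add: edge_sym P.m_assoc)
  have e4: "edge (g \<otimes>\<^bsub>P\<^esub> b) v g" using assms edge_mult[of g v b] by (simp add: edge_sym)
  have "a \<noteq> b" "a \<noteq> \<one>\<^bsub>P\<^esub>" "b \<noteq> \<one>\<^bsub>P\<^esub>" "a \<otimes>\<^bsub>P\<^esub> b \<noteq> \<one>\<^bsub>P\<^esub>"
    using assms uv syl_label_unique syl_not_one syl_mult_not_one by blast+
  then have "distinct [g, g \<otimes>\<^bsub>P\<^esub> a, g \<otimes>\<^bsub>P\<^esub> a \<otimes>\<^bsub>P\<^esub> b, g \<otimes>\<^bsub>P\<^esub> b]"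
    using assms cl by (auto simp: P.m_assoc com P.r_cancel_one' P.l_cancel_one')
  then show ?thesis
    unfolding is_square_def edges_Q_pair using e1 e2 e3 e4 n1 n2 by blast
qed

section \<open>Conjugates of vertex-groups along edges\<close>

definition vconj :: "('v \<times> 'a) list set set \<Rightarrow> 'v \<Rightarrow> ('v \<times> 'a) list set set set" where
  "vconj x u = conjugate_subgroup P x (vertex_subgroup \<Gamma> G u)"

lemma vconj_eq: "vconj x u = (\<lambda>a. x \<otimes>\<^bsub>P\<^esub> a \<otimes>\<^bsub>P\<^esub> inv\<^bsub>P\<^esub> x) ` vertex_subgroup \<Gamma> G u"
  by (auto simp: vconj_def conjugate_subgroup_def l_coset_def r_coset_def)

lemma vconj_subset:
  assumes "x \<in> carrier P" "k \<in> carrier P" "u \<in> verts \<Gamma>"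
    and "\<And>a. a \<in> vertex_subgroup \<Gamma> G u \<Longrightarrow> k \<otimes>\<^bsub>P\<^esub> a \<otimes>\<^bsub>P\<^esub> inv\<^bsub>P\<^esub> k \<in> vertex_subgroup \<Gamma> G u"
  shows "vconj (x \<otimes>\<^bsub>P\<^esub> k) u \<subseteq> vconj x u"
proof
  fix y assume "y \<in> vconj (x \<otimes>\<^bsub>P\<^esub> k) u"
  then obtain a where a: "a \<in> vertex_subgroup \<Gamma> G u"
    "y = (x \<otimes>\<^bsub>P\<^esub> k) \<otimes>\<^bsub>P\<^esub> a \<otimes>\<^bsub>P\<^esub> inv\<^bsub>P\<^esub> (x \<otimes>\<^bsub>P\<^esub> k)"
    by (auto simp: vconj_eq)
  moreover have "a \<in> carrier P" using a assms vertex_subgroup_subgroup subgroup.mem_carrier by metis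
  ultimately have "y = x \<otimes>\<^bsub>P\<^esub> (k \<otimes>\<^bsub>P\<^esub> a \<otimes>\<^bsub>P\<^esub> inv\<^bsub>P\<^esub> k) \<otimes>\<^bsub>P\<^esub> inv\<^bsub>P\<^esub> x"
    using assms by (simp add: P_simps)
  then show "y \<in> vconj x u" using assms a by (auto simp: vconj_eq)
qed

text \<open>Syllables labelled by \<open>u\<close> normalize \<open>G u\<close> from within, those
  labelled by a neighbor centralize it.\<close>

lemma syl_normalizes:
  assumes "syl v k" "v \<in> nbhd u" "a \<in> vertex_subgroup \<Gamma> G u"
  shows "k \<otimes>\<^bsub>P\<^esub> a \<otimes>\<^bsub>P\<^esub> inv\<^bsub>P\<^esub> k \<in> vertex_subgroup \<Gamma> G u"
proof (cases "u = v")
  case True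
  then interpret subgroup "vertex_subgroup \<Gamma> G u" P
    using assms by (simp add: vertex_subgroup_subgroup syl_verts)
  have "k \<in> vertex_subgroup \<Gamma> G u" using True assms by (simp add: vertex_subgroup_syl syl_verts)
  then show ?thesis using assms by simp
next
  case False
  then have uv: "adj u v" "u \<in> verts \<Gamma>" using assms adj_verts by (auto simp: nbhd_def)
  then have "a = \<one>\<^bsub>P\<^esub> \<or> syl u a" using assms by (simp add: vertex_subgroup_syl)
  then have "k \<otimes>\<^bsub>P\<^esub> a = a \<otimes>\<^bsub>P\<^esub> k \<and> a \<in> carrier P"
    using syl_commute[OF uv(1) _ assms(1), of a] syl_closed[OF assms(1)] syl_closed[of u a]
    by (elim disjE) simp_all
  then have "k \<otimes>\<^bsub>P\<^esub> a \<otimes>\<^bsub>P\<^esub> inv\<^bsub>P\<^esub> k = a"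
    using assms by (simp add: syl_closed P.m_assoc)
  then show ?thesis using assms by simp
qed

lemma vconj_syl:
  assumes "x \<in> carrier P" "syl v k" "v \<in> nbhd u"
  shows "vconj (x \<otimes>\<^bsub>P\<^esub> k) u = vconj x u"
proof
  have k: "k \<in> carrier P" using assms by (simp add: syl_closed)
  have u: "u \<in> verts \<Gamma>" using assms adj_verts syl_verts by (auto simp: nbhd_def)
  show "vconj (x \<otimes>\<^bsub>P\<^esub> k) u \<subseteq> vconj x u"
    using assms k u by (intro vconj_subset syl_normalizes)
  have "vconj (x \<otimes>\<^bsub>P\<^esub> k \<otimes>\<^bsub>P\<^esub> inv\<^bsub>P\<^esub> k) u \<subseteq> vconj (x \<otimes>\<^bsub>P\<^esub> k) u"
    using assms k u syl_inv by (intro vconj_subset syl_normalizes) auto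
  then show "vconj x u \<subseteq> vconj (x \<otimes>\<^bsub>P\<^esub> k) u"
    using assms k by (simp add: P.m_assoc)
qed

lemma vconj_edge: "edge x v y \<Longrightarrow> v \<in> nbhd u \<Longrightarrow> vconj y u = vconj x u"
  using vconj_syl[of x v "diff x y" u] by (auto simp: edge_def diff_def cancel_inv)

section \<open>Hyperplanes of the Cayley graph\<close>

text \<open>A relation rather than a function, since an edge is an unordered pair and carries no
  preferred endpoint; \<open>edge_conj_pair\<close> shows that it has one value on each
  edge.\<close>

definition edge_conj :: "('v \<times> 'a) list set set set \<Rightarrow> ('v \<times> 'a) list set set set \<Rightarrow> bool" where
  "edge_conj e H \<longleftrightarrow> (\<exists>x u y. e = {x, y} \<and> edge x u y \<and> H = vconj x u)"

lemma edge_conj_pair: "edge x u y \<Longrightarrow> edge_conj {x, y} H \<longleftrightarrow> H = vconj x u"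
proof
  assume e: "edge x u y"
  show "H = vconj x u" if xy: "edge_conj {x, y} H"
  proof -
    obtain a v b where ab: "{x, y} = {a, b}" "edge a v b" "H = vconj a v"
      using xy by (auto simp: edge_conj_def)
    then consider "a = x" "b = y" | "a = y" "b = x" by (auto simp: doubleton_eq_iff)
    then show ?thesis
    proof cases
      case 1
      then have "u = v" using ab(2) edge_label_unique[OF e, of v] by simp
      then show ?thesis using 1 ab(3) by simp
    next
      case 2
      then have "u = v" using ab(2) edge_label_unique[OF e, of v] edge_sym[of x v y] by simp
      then show ?thesis using 2 ab(3) vconj_edge[OF e, of u] by (simp add: nbhd_def)
    qed
  qed
qed (auto simp: edge_conj_def)

lemma elementary_parallel_conj:
  assumes "(e, e') \<in> elementary_parallel Q" "edge_conj e H"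
  shows "edge_conj e' H"
proof -
  consider (square) a b c d where "e = {a, b}" "e' = {c, d}" "is_square Q a b c d"
    | (triangle) a b c where "e = {a, b}" "e' = {b, c}" "is_triangle Q a b c"
    using assms(1) by (auto simp: elementary_parallel_def)
  then show ?thesis
  proof cases
    case square
    then obtain u v where uv: "edge a u b" "edge d u c" "edge a v d" "adj u v"
      by (blast elim: is_square_edges)
    \<comment> \<open>Opposite edges of the square are joined by an edge labelled by the neighbor
      \<open>v\<close> of \<open>u\<close>, which preserves the conjugate.\<close>
    then have "H = vconj d u"
      using assms square edge_conj_pair vconj_edge[of a v d u] by (auto simp: nbhd_def)
    then show ?thesis using square uv edge_conj_pair[of d u c] by (simp add: insert_commute)
  next
    case triangle
    then obtain u v w where uv: "edge a u b" "edge b v c" "edge a w c"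
      by (auto simp: is_triangle_def edges_Q_pair)
    then have "u = v" using edge_triangle by blast
    then have "H = vconj b v"
      using assms triangle uv edge_conj_pair vconj_edge[of a u b u] by (auto simp: nbhd_def)
    then show ?thesis using triangle uv edge_conj_pair by simp
  qed
qed

lemma parallel_conj: "(e, e') \<in> parallel Q \<Longrightarrow> edge_conj e H \<Longrightarrow> edge_conj e' H"
proof -
  assume "(e, e') \<in> parallel Q" "edge_conj e H"
  then have "(e, e') \<in> (elementary_parallel Q)\<^sup>*" by (simp add: parallel_def)
  then show ?thesis
    using \<open>edge_conj e H\<close> by (induction rule: rtrancl_induct) (auto intro: elementary_parallel_conj)
qed

text \<open>The hyperplane \<open>xJ_u\<close>. The union over all syllables avoids choosing one; by
  \<open>hyp_eq\<close> every syllable gives the same class.\<close>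

definition hyp :: "('v \<times> 'a) list set set \<Rightarrow> 'v \<Rightarrow> ('v \<times> 'a) list set set set set" where
  "hyp x u = (\<Union>a\<in>{a. syl u a}. parallel Q `` {{x, x \<otimes>\<^bsub>P\<^esub> a}})"

lemma hyp_eq:
  assumes "x \<in> carrier P" "syl u a"
  shows "hyp x u = parallel Q `` {{x, x \<otimes>\<^bsub>P\<^esub> a}}"
proof -
  have "parallel Q `` {{x, x \<otimes>\<^bsub>P\<^esub> b}} = parallel Q `` {{x, x \<otimes>\<^bsub>P\<^esub> a}}" if b: "syl u b" for b
  proof (cases "a = b")
    case False
    have cl: "a \<in> carrier P" "b \<in> carrier P" using assms b by (simp_all add: syl_closed)
    have e: "edge x u (x \<otimes>\<^bsub>P\<^esub> a)" "edge x u (x \<otimes>\<^bsub>P\<^esub> b)" using assms b by (simp_all add: edge_mult)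
    \<comment> \<open>Two distinct edges at \<open>x\<close> with label \<open>u\<close> are sides
      of a triangle, whose third side is this quotient.\<close>
    have "inv\<^bsub>P\<^esub> b \<otimes>\<^bsub>P\<^esub> a \<noteq> \<one>\<^bsub>P\<^esub>"
      using False cl by (metis P.inv_closed P.inv_equality P.inv_inv)
    then have "edge (x \<otimes>\<^bsub>P\<^esub> b) u (x \<otimes>\<^bsub>P\<^esub> a)"
      using syl_mult[OF syl_inv[OF b] assms(2)] assms cl
      by (simp add: edge_def diff_def P_simps)
    moreover have "distinct [x \<otimes>\<^bsub>P\<^esub> b, x, x \<otimes>\<^bsub>P\<^esub> a]"
      using False cl assms b syl_not_one by (auto simp: P.r_cancel_one' P.l_cancel_one')
    ultimately have "is_triangle Q (x \<otimes>\<^bsub>P\<^esub> b) x (x \<otimes>\<^bsub>P\<^esub> a)"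
      unfolding is_triangle_def edges_Q_pair using e edge_sym by blast
    then have "({x \<otimes>\<^bsub>P\<^esub> b, x}, {x, x \<otimes>\<^bsub>P\<^esub> a}) \<in> parallel Q" by (rule parallel_triangle)
    from equiv_class_eq[OF equiv_parallel this] show ?thesis by (simp add: insert_commute)
  qed simp
  then have "hyp x u = (\<Union>b\<in>{a. syl u a}. parallel Q `` {{x, x \<otimes>\<^bsub>P\<^esub> a}})"
    unfolding hyp_def by (intro SUP_cong) simp_all
  also have "\<dots> = parallel Q `` {{x, x \<otimes>\<^bsub>P\<^esub> a}}"
    using assms(2) by (intro SUP_const) blast
  finally show ?thesis .
qed

lemma hyp_edge: "edge x u y \<Longrightarrow> hyp x u = parallel Q `` {{x, y}}"
  using hyp_eq[of x u "diff x y"] by (simp add: edge_def diff_def cancel_inv)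

text \<open>For \<open>v = u\<close> the same edge is read from its other end; for \<open>v\<close>
  adjacent to \<open>u\<close> the two \<open>u\<close>-edges are opposite in a square.\<close>

lemma hyp_adjacent:
  assumes "edge x v y" "v \<in> nbhd u"
  shows "hyp y u = hyp x u"
proof (cases "v = u")
  case True
  then show ?thesis using assms hyp_edge[of x u y] hyp_edge[of y u x] edge_sym
    by (simp add: insert_commute)
next
  case False
  then have uv: "adj u v" using assms by (simp add: nbhd_def)
  obtain a where a: "syl u a" using syl_exists adj_verts[OF uv] by blast
  let ?k = "diff x y"
  have x: "x \<in> carrier P" "y \<in> carrier P" "syl v ?k" using assms by (simp_all add: edge_def)
  have y: "x \<otimes>\<^bsub>P\<^esub> ?k = y" using x by (simp add: diff_def cancel_inv)
  have cl: "a \<in> carrier P" "?k \<in> carrier P" using a x(3) syl_closed by blast+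
  have "x \<otimes>\<^bsub>P\<^esub> a \<otimes>\<^bsub>P\<^esub> ?k = x \<otimes>\<^bsub>P\<^esub> (?k \<otimes>\<^bsub>P\<^esub> a)"
    using cl x(1) syl_commute[OF uv a x(3)] by (simp add: P.m_assoc)
  also have "\<dots> = x \<otimes>\<^bsub>P\<^esub> ?k \<otimes>\<^bsub>P\<^esub> a" using cl x(1) by (simp add: P.m_assoc)
  finally have "x \<otimes>\<^bsub>P\<^esub> a \<otimes>\<^bsub>P\<^esub> ?k = y \<otimes>\<^bsub>P\<^esub> a" by (simp only: y)
  then have "({x, x \<otimes>\<^bsub>P\<^esub> a}, {y \<otimes>\<^bsub>P\<^esub> a, y}) \<in> parallel Q"
    using parallel_square[OF is_square_syl[OF x(1) uv a x(3)]] y by simp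
  from equiv_class_eq[OF equiv_parallel this] show ?thesis
    using hyp_eq[OF x(1) a] hyp_eq[OF x(2) a] by (simp add: insert_commute)
qed

text \<open>\<open>hyp_adjacent\<close> is iterated along the path spelled by a word with labels in
  the star of \<open>u\<close>.\<close>

lemma hyp_parab:
  assumes "x \<in> carrier P" "k \<in> parab (nbhd u)"
  shows "hyp (x \<otimes>\<^bsub>P\<^esub> k) u = hyp x u"
proof -
  obtain w where w: "reduced w" "fst ` set w \<subseteq> nbhd u" "k = elt w"
    using assms by (blast elim: parab_reduced)
  from w(1,2) assms(1) have "hyp (x \<otimes>\<^bsub>P\<^esub> elt w) u = hyp x u"
  proof (induction w arbitrary: x rule: reduced.induct)
    case (2 v s w)
    have s: "syl v (\<iota> v s)" using 2 by (auto simp: syl_def)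
    have "hyp (x \<otimes>\<^bsub>P\<^esub> \<iota> v s \<otimes>\<^bsub>P\<^esub> elt w) u = hyp (x \<otimes>\<^bsub>P\<^esub> \<iota> v s) u"
      using 2 s by (simp add: syl_closed)
    also have "\<dots> = hyp x u"
      using 2 s by (intro hyp_adjacent[of _ v]) (auto simp: edge_mult)
    finally show ?case
      using 2 s by (simp add: elt_Cons reduced_in_W elt_closed syl_closed P.m_assoc)
  qed (simp add: elt_Nil)
  then show ?thesis using w by simp
qed

section \<open>Translation of hyperplanes and the base hyperplanes\<close>

lemma l_coset_pair: "g <#\<^bsub>P\<^esub> {x, y} = {g \<otimes>\<^bsub>P\<^esub> x, g \<otimes>\<^bsub>P\<^esub> y}"
  by (auto simp: l_coset_def)

lemma elementary_parallel_translate: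
  assumes "g \<in> carrier P" "(e, e') \<in> elementary_parallel Q"
  shows "(g <#\<^bsub>P\<^esub> e, g <#\<^bsub>P\<^esub> e') \<in> elementary_parallel Q"
proof -
  have E: "{g \<otimes>\<^bsub>P\<^esub> x, g \<otimes>\<^bsub>P\<^esub> y} \<in> edges Q \<longleftrightarrow> {x, y} \<in> edges Q"
    if "x \<in> carrier P" "y \<in> carrier P" for x y
    using that assms(1) by (simp add: edges_Q_pair edge_translate)
  have inj: "g \<otimes>\<^bsub>P\<^esub> x = g \<otimes>\<^bsub>P\<^esub> y \<longleftrightarrow> x = y" if "x \<in> carrier P" "y \<in> carrier P" for x y
    using P.Units_l_cancel[of g x y] that assms(1) by simp
  have cl: "x \<in> carrier P \<and> y \<in> carrier P" if "{x, y} \<in> edges Q" for x y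
    using that by (auto simp: edges_Q_pair edge_def)
  consider (square) a b c d where "e = {a, b}" "e' = {c, d}" "is_square Q a b c d"
    | (triangle) a b c where "e = {a, b}" "e' = {b, c}" "is_triangle Q a b c"
    using assms(2) by (auto simp: elementary_parallel_def)
  then show ?thesis
  proof cases
    case square
    then have c: "a \<in> carrier P" "b \<in> carrier P" "c \<in> carrier P" "d \<in> carrier P"
      using cl by (auto simp: is_square_def)
    then have "is_square Q (g \<otimes>\<^bsub>P\<^esub> a) (g \<otimes>\<^bsub>P\<^esub> b) (g \<otimes>\<^bsub>P\<^esub> c) (g \<otimes>\<^bsub>P\<^esub> d)"
      using square(3) unfolding is_square_def
      by (simp add: E[OF c(1,2)] E[OF c(2,3)] E[OF c(3,4)] E[OF c(4,1)] E[OF c(1,3)] E[OF c(2,4)]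
          inj[OF c(1,2)] inj[OF c(1,3)] inj[OF c(1,4)] inj[OF c(2,3)] inj[OF c(2,4)] inj[OF c(3,4)])
    then show ?thesis
      unfolding square(1,2) l_coset_pair elementary_parallel_def
      by (intro UnI1 CollectI exI conjI) (rule HOL.refl)
  next
    case triangle
    then have c: "a \<in> carrier P" "b \<in> carrier P" "c \<in> carrier P"
      using cl by (auto simp: is_triangle_def)
    then have "is_triangle Q (g \<otimes>\<^bsub>P\<^esub> a) (g \<otimes>\<^bsub>P\<^esub> b) (g \<otimes>\<^bsub>P\<^esub> c)"
      using triangle(3) unfolding is_triangle_def
      by (simp add: E[OF c(1,2)] E[OF c(2,3)] E[OF c(1,3)] inj[OF c(1,2)] inj[OF c(1,3)] inj[OF c(2,3)])
    then show ?thesis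
      unfolding triangle(1,2) l_coset_pair elementary_parallel_def
      by (intro UnI2 CollectI exI conjI) (rule HOL.refl)
  qed
qed

lemma parallel_translate:
  assumes "g \<in> carrier P" "(e, e') \<in> parallel Q"
  shows "(g <#\<^bsub>P\<^esub> e, g <#\<^bsub>P\<^esub> e') \<in> parallel Q"
proof -
  have "(e, e') \<in> (elementary_parallel Q)\<^sup>*" using assms by (simp add: parallel_def)
  then have "(g <#\<^bsub>P\<^esub> e, g <#\<^bsub>P\<^esub> e') \<in> (elementary_parallel Q)\<^sup>*"
    by (induction rule: rtrancl_induct)
      (auto intro: rtrancl_into_rtrancl elementary_parallel_translate[OF assms(1)])
  moreover have "g <#\<^bsub>P\<^esub> f \<in> edges Q" if f: "f \<in> edges Q" for f
  proof -
    obtain x u y where "f = {x, y}" "edge x u y" using f by (auto simp: edges_Q)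
    then show ?thesis using assms(1) edge_translate[of g x y u]
      by (auto simp: l_coset_pair edges_Q_pair edge_def)
  qed
  ultimately show ?thesis using assms by (auto simp: parallel_def)
qed

lemma translate_hyp_subset:
  assumes "g \<in> carrier P" "x \<in> carrier P" "u \<in> verts \<Gamma>"
  shows "translate P g (hyp x u) \<subseteq> hyp (g \<otimes>\<^bsub>P\<^esub> x) u"
proof -
  obtain a where a: "syl u a" using syl_exists assms by blast
  show ?thesis
    using assms a parallel_translate[OF assms(1), of "{x, x \<otimes>\<^bsub>P\<^esub> a}"]
    by (auto simp: hyp_eq translate_def l_coset_pair P.m_assoc syl_closed)
qed

text \<open>The reverse inclusion is the first one applied to the inverse of
  \<open>g\<close>.\<close>

lemma translate_hyp:
  assumes "g \<in> carrier P" "x \<in> carrier P" "u \<in> verts \<Gamma>"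
  shows "translate P g (hyp x u) = hyp (g \<otimes>\<^bsub>P\<^esub> x) u"
proof
  show "hyp (g \<otimes>\<^bsub>P\<^esub> x) u \<subseteq> translate P g (hyp x u)"
  proof
    fix f assume f: "f \<in> hyp (g \<otimes>\<^bsub>P\<^esub> x) u"
    then have "f \<in> edges Q" by (auto simp: hyp_def parallel_def)
    then have "f \<subseteq> carrier P" by (auto simp: edges_Q edge_def)
    then have "f = g <#\<^bsub>P\<^esub> (inv\<^bsub>P\<^esub> g <#\<^bsub>P\<^esub> f)"
      using assms by (simp add: P.lcos_m_assoc P.lcos_mult_one)
    moreover have "inv\<^bsub>P\<^esub> g <#\<^bsub>P\<^esub> f \<in> translate P (inv\<^bsub>P\<^esub> g) (hyp (g \<otimes>\<^bsub>P\<^esub> x) u)"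
      using f by (auto simp: translate_def)
    then have "inv\<^bsub>P\<^esub> g <#\<^bsub>P\<^esub> f \<in> hyp x u"
      using translate_hyp_subset[of "inv\<^bsub>P\<^esub> g" "g \<otimes>\<^bsub>P\<^esub> x" u] assms
      by (auto simp: cancel_inv)
    ultimately show "f \<in> translate P g (hyp x u)" by (auto simp: translate_def)
  qed
qed (rule translate_hyp_subset[OF assms])

lemma hyp_hyperplane:
  assumes "x \<in> carrier P" "u \<in> verts \<Gamma>"
  shows "hyp x u \<in> hyperplanes Q"
proof -
  obtain a where a: "syl u a" using syl_exists assms by blast
  then have "{x, x \<otimes>\<^bsub>P\<^esub> a} \<in> edges Q" using assms edge_mult by (auto simp: edges_Q_pair)
  then show ?thesis using hyp_eq[OF assms(1) a] by (auto simp: hyperplanes_def intro: quotientI)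
qed

text \<open>All edges of the clique \<open>G u\<close> are reached from the identity inside the
  parabolic subgroup of the star. Uniqueness follows since this clique has an edge and distinct
  hyperplanes are disjoint.\<close>

lemma base_hyperplane_hyp:
  assumes u: "u \<in> verts \<Gamma>"
  shows "base_hyperplane \<Gamma> G u = hyp \<one>\<^bsub>P\<^esub> u"
  unfolding base_hyperplane_def
proof (rule the_equality, intro conjI)
  let ?E = "edges (induced_subgraph Q (vertex_subgroup \<Gamma> G u))"
  show h: "hyp \<one>\<^bsub>P\<^esub> u \<in> hyperplanes Q" using u by (simp add: hyp_hyperplane)
  show sub: "?E \<subseteq> hyp \<one>\<^bsub>P\<^esub> u"
  proof
    fix e assume "e \<in> ?E"
    then obtain x w y where e: "e = {x, y}" "edge x w y" "x \<in> vertex_subgroup \<Gamma> G u"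
      "y \<in> vertex_subgroup \<Gamma> G u"
      by (auto simp: induced_subgraph_def edges_Q)
    then have "diff x y \<in> vertex_subgroup \<Gamma> G u"
      using vertex_subgroup_subgroup[OF u]
      by (simp add: diff_def subgroup.m_closed subgroup.m_inv_closed)
    then have "w = u"
      using e syl_not_one syl_label_unique u by (auto simp: vertex_subgroup_syl edge_def)
    moreover have "e \<in> edges Q" using e edges_Q_pair by blast
    ultimately have "e \<in> hyp x u"
      using e(1,2) hyp_edge[of x u y] equiv_class_self[OF equiv_parallel, of e Q] by simp
    moreover have "x \<in> parab (nbhd u)"
      using e u by (auto simp: vertex_subgroup_eq nbhd_def \<iota>_parab)
    then have "hyp x u = hyp \<one>\<^bsub>P\<^esub> u"
      using hyp_parab[of "\<one>\<^bsub>P\<^esub>" x u] by (simp add: parab_closed)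
    ultimately show "e \<in> hyp \<one>\<^bsub>P\<^esub> u" by simp
  qed
  fix J assume J: "J \<in> hyperplanes Q \<and> ?E \<subseteq> J"
  obtain a where a: "syl u a" using syl_exists u by blast
  then have "{\<one>\<^bsub>P\<^esub>, a} \<in> edges Q"
    using edge_mult[of "\<one>\<^bsub>P\<^esub>" u a] by (auto simp: edges_Q_pair syl_closed)
  then have "{\<one>\<^bsub>P\<^esub>, a} \<in> ?E"
    using a u by (simp add: induced_subgraph_def vertex_subgroup_syl)
  then have "{\<one>\<^bsub>P\<^esub>, a} \<in> J \<inter> hyp \<one>\<^bsub>P\<^esub> u" using J sub by blast
  then show "J = hyp \<one>\<^bsub>P\<^esub> u"
    using quotient_disj[OF equiv_parallel, of J Q "hyp \<one>\<^bsub>P\<^esub> u"] J h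
    by (auto simp: hyperplanes_def)
qed

section \<open>The map from hyperplanes to conjugates\<close>

lemma hyp_vconj:
  assumes "x \<in> carrier P" "u \<in> verts \<Gamma>" "e \<in> hyp x u"
  shows "edge_conj e (vconj x u)"
proof -
  obtain a where a: "syl u a" using syl_exists assms by blast
  have "({x, x \<otimes>\<^bsub>P\<^esub> a}, e) \<in> parallel Q" using assms(3) by (simp add: hyp_eq[OF assms(1) a])
  then show ?thesis
    by (rule parallel_conj) (simp add: edge_conj_pair[OF edge_mult[OF assms(1) a]])
qed

lemma hyp_nonempty:
  assumes "x \<in> carrier P" "u \<in> verts \<Gamma>"
  obtains e where "e \<in> hyp x u"
proof -
  have "hyp x u \<noteq> {}"
    using hyp_hyperplane[OF assms] in_quotient_imp_non_empty[OF equiv_parallel]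
    by (simp add: hyperplanes_def)
  then show ?thesis using that by blast
qed

lemma edge_conj_unique: "edge_conj e H \<Longrightarrow> edge_conj e H' \<Longrightarrow> H = H'"
proof -
  assume H: "edge_conj e H" "edge_conj e H'"
  then obtain x u y where xy: "e = {x, y}" "edge x u y" by (auto simp: edge_conj_def)
  show ?thesis using H by (simp add: xy(1) edge_conj_pair[OF xy(2)])
qed

text \<open>Defined on the hyperplane itself through any of its edges, not through a pair
  \<open>(g, u)\<close>; independence of the presentation is thus built in.\<close>

definition hyp_conj :: "('v \<times> 'a) list set set set set \<Rightarrow> ('v \<times> 'a) list set set set" where
  "hyp_conj J = (THE H. \<exists>e\<in>J. edge_conj e H)"

lemma hyp_conj_hyp:
  assumes "x \<in> carrier P" "u \<in> verts \<Gamma>"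
  shows "hyp_conj (hyp x u) = vconj x u"
  unfolding hyp_conj_def
proof (rule the_equality)
  show "\<exists>e\<in>hyp x u. edge_conj e (vconj x u)"
    using hyp_nonempty[OF assms] hyp_vconj[OF assms] by metis
  show "H = vconj x u" if "\<exists>e\<in>hyp x u. edge_conj e H" for H
    using that hyp_vconj[OF assms] edge_conj_unique by blast
qed

text \<open>The quotient \<open>?k\<close> conjugates a non-trivial element of \<open>G v\<close>
  into \<open>G u\<close>. The key fact for \<open>{u}\<close> gives \<open>v = u\<close> and places
  \<open>?k\<close> in the parabolic subgroup of the star, which fixes the hyperplane.\<close>

lemma vconj_eq_imp_hyp_eq:
  assumes "g \<in> carrier P" "h \<in> carrier P" "u \<in> verts \<Gamma>" "v \<in> verts \<Gamma>" "vconj g u = vconj h v"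
  shows "hyp g u = hyp h v"
proof -
  let ?k = "inv\<^bsub>P\<^esub> g \<otimes>\<^bsub>P\<^esub> h"
  obtain b where b: "syl v b" using syl_exists assms by blast
  have "h \<otimes>\<^bsub>P\<^esub> b \<otimes>\<^bsub>P\<^esub> inv\<^bsub>P\<^esub> h \<in> vconj h v"
    using b assms(4) by (simp add: vconj_eq vertex_subgroup_syl)
  then obtain a where a: "a \<in> vertex_subgroup \<Gamma> G u"
    "h \<otimes>\<^bsub>P\<^esub> b \<otimes>\<^bsub>P\<^esub> inv\<^bsub>P\<^esub> h = g \<otimes>\<^bsub>P\<^esub> a \<otimes>\<^bsub>P\<^esub> inv\<^bsub>P\<^esub> g"
    unfolding assms(5)[symmetric] unfolding vconj_eq[of g u] by blast
  have aP: "a \<in> parab {u}" using a(1) assms(3) by (auto simp: vertex_subgroup_eq \<iota>_parab)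
  have cl: "a \<in> carrier P" "b \<in> carrier P" "?k \<in> carrier P"
    using parab_closed[OF aP] syl_closed[OF b] assms by simp_all
  have "a \<otimes>\<^bsub>P\<^esub> ?k = inv\<^bsub>P\<^esub> g \<otimes>\<^bsub>P\<^esub> (g \<otimes>\<^bsub>P\<^esub> a \<otimes>\<^bsub>P\<^esub> inv\<^bsub>P\<^esub> g) \<otimes>\<^bsub>P\<^esub> h"
    using assms(1,2) cl by (simp add: P_simps)
  also have "\<dots> = ?k \<otimes>\<^bsub>P\<^esub> b"
    unfolding a(2)[symmetric] using assms(1,2) cl by (simp add: P_simps)
  finally have eq: "a \<otimes>\<^bsub>P\<^esub> ?k = ?k \<otimes>\<^bsub>P\<^esub> b" .
  obtain p q where pq: "v \<in> {u}" "p \<in> parab {u}" "q \<in> parab (nbhd v)" "?k = p \<otimes>\<^bsub>P\<^esub> q"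
    by (rule conj_in_parab[OF cl(3) aP b eq])
  have v: "v = u" using pq(1) by simp
  have "p \<in> parab (nbhd u)" using pq(2) parab_mono[of "{u}" "nbhd u"] by (auto simp: nbhd_def)
  then have k: "?k \<in> parab (nbhd u)" using pq(3,4) parab_mult v by simp
  have "hyp (g \<otimes>\<^bsub>P\<^esub> ?k) u = hyp g u" using assms(1) k by (rule hyp_parab)
  then show ?thesis using v assms(1,2) by (simp add: cancel_inv)
qed

text \<open>Both conjugates can be based at the corner \<open>a\<close> of a common square, where
  they become conjugates by the same element of vertex-groups with adjacent indices.\<close>

lemma transverse_imp_commuting:
  assumes "g \<in> carrier P" "h \<in> carrier P" "u \<in> verts \<Gamma>" "v \<in> verts \<Gamma>"
    and "transverse Q (hyp g u) (hyp h v)"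
  shows "vconj g u \<noteq> vconj h v \<and> commuting_subgroups P (vconj g u) (vconj h v)"
proof -
  obtain a b c d where sq: "is_square Q a b c d" "{a, b} \<in> hyp g u" "{b, c} \<in> hyp h v"
    using assms(5) unfolding transverse_def by blast
  obtain i j where e: "edge a i b" "edge b j c" "adj i j"
    using sq(1) by (blast elim: is_square_edges)
  have "vconj g u = vconj a i"
    using hyp_vconj[OF assms(1,3) sq(2)] edge_conj_pair[OF e(1)] by simp
  moreover have "vconj h v = vconj a j"
    using hyp_vconj[OF assms(2,4) sq(3)] edge_conj_pair[OF e(2)] vconj_edge[OF e(1), of j] e(3)
    by (simp add: nbhd_def adj_sym)
  moreover have "commuting_subgroups P (vconj a i) (vconj a j)"
    unfolding commuting_subgroups_def vconj_eq
  proof (intro ballI, elim imageE)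
    fix x y s t
    assume xy: "x = a \<otimes>\<^bsub>P\<^esub> s \<otimes>\<^bsub>P\<^esub> inv\<^bsub>P\<^esub> a" "s \<in> vertex_subgroup \<Gamma> G i"
      "y = a \<otimes>\<^bsub>P\<^esub> t \<otimes>\<^bsub>P\<^esub> inv\<^bsub>P\<^esub> a" "t \<in> vertex_subgroup \<Gamma> G j"
    obtain s' t' where st: "s' \<in> carrier (G i)" "s = \<iota> i s'" "t' \<in> carrier (G j)" "t = \<iota> j t'"
      using xy unfolding vertex_subgroup_eq by blast
    have c: "s \<otimes>\<^bsub>P\<^esub> t = t \<otimes>\<^bsub>P\<^esub> s" unfolding st using e(3) st by (intro \<iota>_commute)
    have cl: "a \<in> carrier P" "s \<in> carrier P" "t \<in> carrier P"
      using e(1) st adj_verts[OF e(3)] by (auto simp: edge_def \<iota>_closed)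
    have "x \<otimes>\<^bsub>P\<^esub> y = a \<otimes>\<^bsub>P\<^esub> (s \<otimes>\<^bsub>P\<^esub> t) \<otimes>\<^bsub>P\<^esub> inv\<^bsub>P\<^esub> a" using cl by (simp add: xy P_simps)
    also have "\<dots> = y \<otimes>\<^bsub>P\<^esub> x" unfolding c using cl by (simp add: xy P_simps)
    finally show "x \<otimes>\<^bsub>P\<^esub> y = y \<otimes>\<^bsub>P\<^esub> x" .
  qed
  moreover have "vconj a i \<noteq> vconj a j"
  proof
    assume eq: "vconj a i = vconj a j"
    have cl: "a \<in> carrier P" "i \<in> verts \<Gamma>" "j \<in> verts \<Gamma>"
      using e adj_verts by (auto simp: edge_def)
    obtain s where s: "syl i s" using syl_exists cl by blast
    have "a \<otimes>\<^bsub>P\<^esub> s \<otimes>\<^bsub>P\<^esub> inv\<^bsub>P\<^esub> a \<in> vconj a j"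
      unfolding eq[symmetric] using s cl by (simp add: vconj_eq vertex_subgroup_syl)
    then obtain t where t: "t \<in> vertex_subgroup \<Gamma> G j"
      "a \<otimes>\<^bsub>P\<^esub> s \<otimes>\<^bsub>P\<^esub> inv\<^bsub>P\<^esub> a = a \<otimes>\<^bsub>P\<^esub> t \<otimes>\<^bsub>P\<^esub> inv\<^bsub>P\<^esub> a"
      unfolding vconj_eq by blast
    have "t \<in> carrier P" using t(1) subgroup.mem_carrier[OF vertex_subgroup_subgroup[OF cl(3)]] by blast
    then have "s = t" using t(2) cl(1) syl_closed[OF s] by simp
    then have "syl j s" using t(1) syl_not_one[OF s] cl by (simp add: vertex_subgroup_syl)
    then show False using syl_label_unique[OF s, of j] e(3) by simp
  qed
  ultimately show ?thesis by simp
qed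

text \<open>The key fact is used twice: first to place \<open>?q\<close> in the parabolic subgroup
  of the star of \<open>u\<close>, then to split \<open>?k\<close> so that both hyperplanes contain
  edges at the common vertex \<open>g\<close> times \<open>x\<close>.\<close>

lemma commuting_imp_transverse:
  assumes "g \<in> carrier P" "h \<in> carrier P" "u \<in> verts \<Gamma>" "v \<in> verts \<Gamma>"
    and ne: "vconj g u \<noteq> vconj h v" and com: "commuting_subgroups P (vconj g u) (vconj h v)"
  shows "transverse Q (hyp g u) (hyp h v)"
proof -
  let ?k = "inv\<^bsub>P\<^esub> g \<otimes>\<^bsub>P\<^esub> h"
  obtain a b where ab: "syl u a" "syl v b" using syl_exists assms by blast
  let ?q = "?k \<otimes>\<^bsub>P\<^esub> b \<otimes>\<^bsub>P\<^esub> inv\<^bsub>P\<^esub> ?k"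
  have cl: "a \<in> carrier P" "b \<in> carrier P" "?k \<in> carrier P" "?q \<in> carrier P"
    using syl_closed[OF ab(1)] syl_closed[OF ab(2)] assms(1,2) by simp_all
  have "g \<otimes>\<^bsub>P\<^esub> a \<otimes>\<^bsub>P\<^esub> inv\<^bsub>P\<^esub> g \<in> vconj g u" "h \<otimes>\<^bsub>P\<^esub> b \<otimes>\<^bsub>P\<^esub> inv\<^bsub>P\<^esub> h \<in> vconj h v"
    using ab assms(3,4) by (simp_all add: vconj_eq vertex_subgroup_syl)
  then have c: "(g \<otimes>\<^bsub>P\<^esub> a \<otimes>\<^bsub>P\<^esub> inv\<^bsub>P\<^esub> g) \<otimes>\<^bsub>P\<^esub> (h \<otimes>\<^bsub>P\<^esub> b \<otimes>\<^bsub>P\<^esub> inv\<^bsub>P\<^esub> h) =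
      (h \<otimes>\<^bsub>P\<^esub> b \<otimes>\<^bsub>P\<^esub> inv\<^bsub>P\<^esub> h) \<otimes>\<^bsub>P\<^esub> (g \<otimes>\<^bsub>P\<^esub> a \<otimes>\<^bsub>P\<^esub> inv\<^bsub>P\<^esub> g)"
    using com unfolding commuting_subgroups_def by blast
  have "a \<otimes>\<^bsub>P\<^esub> ?q = inv\<^bsub>P\<^esub> g \<otimes>\<^bsub>P\<^esub>
      ((g \<otimes>\<^bsub>P\<^esub> a \<otimes>\<^bsub>P\<^esub> inv\<^bsub>P\<^esub> g) \<otimes>\<^bsub>P\<^esub> (h \<otimes>\<^bsub>P\<^esub> b \<otimes>\<^bsub>P\<^esub> inv\<^bsub>P\<^esub> h)) \<otimes>\<^bsub>P\<^esub> g"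
    using assms(1,2) cl by (simp add: P_simps)
  also have "\<dots> = ?q \<otimes>\<^bsub>P\<^esub> a"
    unfolding c using assms(1,2) cl by (simp add: P_simps)
  finally have eq: "a \<otimes>\<^bsub>P\<^esub> ?q = ?q \<otimes>\<^bsub>P\<^esub> a" .
  have a: "a \<in> parab {u}" using ab(1) by (auto simp: syl_def \<iota>_parab)
  \<comment> \<open>The conjugator is now \<open>?q\<close>, which commutes with the non-trivial
    element \<open>a\<close> of \<open>G u\<close>.\<close>
  obtain p r where pr: "p \<in> parab {u}" "r \<in> parab (nbhd u)" "?q = p \<otimes>\<^bsub>P\<^esub> r"
    by (rule conj_in_parab[OF cl(4) a ab(1) eq])
  have "p \<in> parab (nbhd u)" using pr(1) parab_mono[of "{u}" "nbhd u"] by (auto simp: nbhd_def)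
  then have q: "?q \<in> parab (nbhd u)" unfolding pr(3) using pr(2) by (rule parab_mult)
  have eq2: "?q \<otimes>\<^bsub>P\<^esub> ?k = ?k \<otimes>\<^bsub>P\<^esub> b" using cl(2,3) by (simp add: P.m_assoc)
  \<comment> \<open>Here \<open>?k\<close> conjugates \<open>b\<close> to \<open>?q\<close>; the
    factor \<open>x\<close> moves the first hyperplane to itself, and \<open>y\<close> the
    second.\<close>
  obtain x y where xy: "v \<in> nbhd u" "x \<in> parab (nbhd u)" "y \<in> parab (nbhd v)" "?k = x \<otimes>\<^bsub>P\<^esub> y"
    by (rule conj_in_parab[OF cl(3) q ab(2) eq2])
  have xyc: "x \<in> carrier P" "y \<in> carrier P" using xy(2,3) parab_closed by blast+
  have "h = g \<otimes>\<^bsub>P\<^esub> ?k" using assms(1,2) by (simp add: cancel_inv)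
  then have h: "h = (g \<otimes>\<^bsub>P\<^esub> x) \<otimes>\<^bsub>P\<^esub> y" unfolding xy(4) using assms(1) xyc by (simp add: P.m_assoc)
  have hu: "hyp g u = hyp (g \<otimes>\<^bsub>P\<^esub> x) u" using hyp_parab[OF assms(1) xy(2)] by simp
  have hv: "hyp h v = hyp (g \<otimes>\<^bsub>P\<^esub> x) v"
    unfolding h using assms(1) xyc xy(3) by (intro hyp_parab) simp_all
  have gx: "g \<otimes>\<^bsub>P\<^esub> x \<in> carrier P" using assms(1) xyc by simp
  \<comment> \<open>Equal labels would make the two hyperplanes, hence their conjugates,
    equal.\<close>
  have "u \<noteq> v"
  proof
    assume "u = v"
    then have "hyp_conj (hyp g u) = hyp_conj (hyp h v)" using hu hv by simp
    then show False using ne assms(1-4) by (simp add: hyp_conj_hyp)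
  qed
  then have uv: "adj u v" using xy(1) by (simp add: nbhd_def)
  let ?x = "g \<otimes>\<^bsub>P\<^esub> x"
  have sq: "is_square Q ?x (?x \<otimes>\<^bsub>P\<^esub> a) (?x \<otimes>\<^bsub>P\<^esub> a \<otimes>\<^bsub>P\<^esub> b) (?x \<otimes>\<^bsub>P\<^esub> b)"
    by (rule is_square_syl[OF gx uv ab])
  \<comment> \<open>The rotated square exhibits the other pair of opposite edges as
    parallel.\<close>
  have sq': "is_square Q (?x \<otimes>\<^bsub>P\<^esub> b) ?x (?x \<otimes>\<^bsub>P\<^esub> a) (?x \<otimes>\<^bsub>P\<^esub> a \<otimes>\<^bsub>P\<^esub> b)"
    by (rule is_square_rotate[OF is_square_rotate[OF is_square_rotate[OF sq]]])
  have ed: "{?x, ?x \<otimes>\<^bsub>P\<^esub> a} \<in> edges Q" "{?x \<otimes>\<^bsub>P\<^esub> b, ?x} \<in> edges Q"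
    using sq unfolding is_square_def by blast+
  have bx: "{?x, ?x \<otimes>\<^bsub>P\<^esub> b} = {?x \<otimes>\<^bsub>P\<^esub> b, ?x}" by (rule insert_commute)
  have "{?x, ?x \<otimes>\<^bsub>P\<^esub> a} \<in> hyp ?x u" "{?x \<otimes>\<^bsub>P\<^esub> a \<otimes>\<^bsub>P\<^esub> b, ?x \<otimes>\<^bsub>P\<^esub> b} \<in> hyp ?x u"
    unfolding hyp_eq[OF gx ab(1)]
    using equiv_class_self[OF equiv_parallel ed(1)] parallel_square[OF sq] by simp_all
  moreover have "{?x \<otimes>\<^bsub>P\<^esub> b, ?x} \<in> hyp ?x v" "{?x \<otimes>\<^bsub>P\<^esub> a, ?x \<otimes>\<^bsub>P\<^esub> a \<otimes>\<^bsub>P\<^esub> b} \<in> hyp ?x v"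
    unfolding hyp_eq[OF gx ab(2)] bx
    using equiv_class_self[OF equiv_parallel ed(2)] parallel_square[OF sq'] by simp_all
  ultimately show ?thesis
    unfolding transverse_def hu hv using sq by blast
qed

section \<open>Restriction to maximal vertices and the isomorphism\<close>

definition maximal_hyps :: "('v \<times> 'a) list set set set set set" where
  "maximal_hyps = {hyp g u | g u. g \<in> carrier P \<and> prec_maximal \<Gamma> u}"

lemma labelled_by_iff:
  assumes "u \<in> verts \<Gamma>"
  shows "labelled_by \<Gamma> G J u \<longleftrightarrow> (\<exists>g\<in>carrier P. J = hyp g u)"
proof -
  have "translate P g (base_hyperplane \<Gamma> G u) = hyp g u" if "g \<in> carrier P" for g
    using translate_hyp[OF that P.one_closed assms] that
    by (simp add: base_hyperplane_hyp[OF assms])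
  then show ?thesis unfolding labelled_by_def by (intro bex_cong) simp_all
qed

lemma maximal_hyperplane_graph_eq:
  "maximal_hyperplane_graph \<Gamma> G =
    \<lparr>verts = maximal_hyps,
     edges = {{J, H} | J H. J \<in> maximal_hyps \<and> H \<in> maximal_hyps \<and> transverse Q J H}\<rparr>"
proof -
  have "{J \<in> hyperplanes Q. \<exists>u. prec_maximal \<Gamma> u \<and> labelled_by \<Gamma> G J u} = maximal_hyps"
  proof (intro equalityI subsetI)
    fix J assume "J \<in> {J \<in> hyperplanes Q. \<exists>u. prec_maximal \<Gamma> u \<and> labelled_by \<Gamma> G J u}"
    then obtain u where u: "prec_maximal \<Gamma> u" "labelled_by \<Gamma> G J u" by blast
    then have "u \<in> verts \<Gamma>" by (simp add: prec_maximal_def)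
    then show "J \<in> maximal_hyps"
      using u labelled_by_iff[of u J] unfolding maximal_hyps_def by blast
  next
    fix J assume "J \<in> maximal_hyps"
    then obtain g u where g: "J = hyp g u" "g \<in> carrier P" "prec_maximal \<Gamma> u"
      unfolding maximal_hyps_def by blast
    then have u: "u \<in> verts \<Gamma>" by (simp add: prec_maximal_def)
    have "labelled_by \<Gamma> G J u" using g labelled_by_iff[OF u] by blast
    then show "J \<in> {J \<in> hyperplanes Q. \<exists>u. prec_maximal \<Gamma> u \<and> labelled_by \<Gamma> G J u}"
      using g hyp_hyperplane[OF g(2) u] by blast
  qed
  then show ?thesis by (simp add: maximal_hyperplane_graph_def Let_def)
qed

text \<open>Injectivity comes from \<open>vconj_eq_imp_hyp_eq\<close>. The two adjacency relations
  are symmetric, so each can be tested on ordered pairs and compared through the two preceding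
  implications.\<close>

lemma hyp_conj_isomorphism:
  "graph_isomorphism hyp_conj (maximal_hyperplane_graph \<Gamma> G) (small_crossing_graph \<Gamma> G)"
proof -
  let ?C = "{vconj g u | g u. g \<in> carrier P \<and> prec_maximal \<Gamma> u}"
  have max: "u \<in> verts \<Gamma>" if "prec_maximal \<Gamma> u" for u
    using that by (simp add: prec_maximal_def)
  have S: "small_crossing_graph \<Gamma> G =
      \<lparr>verts = ?C, edges = {{H, L} | H L. H \<in> ?C \<and> L \<in> ?C \<and> H \<noteq> L \<and> commuting_subgroups P H L}\<rparr>"
    by (simp add: small_crossing_graph_def vconj_def Let_def)
  have "inj_on hyp_conj maximal_hyps"
  proof (rule inj_onI)
    fix J H assume "J \<in> maximal_hyps" "H \<in> maximal_hyps" and eq: "hyp_conj J = hyp_conj H"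
    then obtain g u h v where "J = hyp g u" "H = hyp h v" "g \<in> carrier P" "h \<in> carrier P"
      "u \<in> verts \<Gamma>" "v \<in> verts \<Gamma>"
      unfolding maximal_hyps_def using max by blast
    then show "J = H" using eq vconj_eq_imp_hyp_eq[of g h u v] by (simp add: hyp_conj_hyp)
  qed
  moreover have "hyp_conj ` maximal_hyps = ?C"
  proof -
    have "hyp_conj (hyp g u) = vconj g u" if "g \<in> carrier P" "prec_maximal \<Gamma> u" for g u
      using that max by (simp add: hyp_conj_hyp)
    then show ?thesis unfolding maximal_hyps_def by (force simp: image_iff)
  qed
  ultimately have bij: "bij_betw hyp_conj maximal_hyps ?C" by (simp add: bij_betw_def)
  have "{J, H} \<in> edges (maximal_hyperplane_graph \<Gamma> G) \<longleftrightarrow>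
      {hyp_conj J, hyp_conj H} \<in> edges (small_crossing_graph \<Gamma> G)"
    if JH: "J \<in> maximal_hyps" "H \<in> maximal_hyps" for J H
  proof -
    have C: "hyp_conj J \<in> ?C" "hyp_conj H \<in> ?C" using bij_betwE[OF bij] JH by blast+
    have "{J, H} \<in> edges (maximal_hyperplane_graph \<Gamma> G) \<longleftrightarrow> transverse Q J H"
      unfolding maximal_hyperplane_graph_eq ugraph.simps
      using transverse_sym JH by (rule pair_in_edges_iff)
    also have "\<dots> \<longleftrightarrow>
        hyp_conj J \<noteq> hyp_conj H \<and> commuting_subgroups P (hyp_conj J) (hyp_conj H)"
    proof -
      obtain g u h v where "J = hyp g u" "H = hyp h v" "g \<in> carrier P" "h \<in> carrier P"
        "u \<in> verts \<Gamma>" "v \<in> verts \<Gamma>"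
        using JH unfolding maximal_hyps_def using max by blast
      then show ?thesis
        using transverse_imp_commuting[of g h u v] commuting_imp_transverse[of g h u v]
        by (simp only: hyp_conj_hyp) blast
    qed
    also have "\<dots> \<longleftrightarrow> {hyp_conj J, hyp_conj H} \<in> edges (small_crossing_graph \<Gamma> G)"
    proof -
      let ?R = "\<lambda>H L. H \<noteq> L \<and> commuting_subgroups P H L"
      have "?R L H" if "?R H L" for H L
        using that unfolding commuting_subgroups_def by metis
      from pair_in_edges_iff[of ?R, OF this C] show ?thesis
        unfolding S ugraph.simps by (rule HOL.sym)
    qed
    finally show ?thesis .
  qed
  then show ?thesis
    using bij unfolding graph_isomorphism_def by (simp add: S maximal_hyperplane_graph_eq)
qed

end

theorem proposition1p15:
  fixes \<Gamma> :: "'v ugraph" and G :: "'v \<Rightarrow> ('a, 'b) monoid_scheme"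
  assumes "simplicial_graph \<Gamma>"
    and "\<And>u. u \<in> verts \<Gamma> \<Longrightarrow> group (G u)"
    and "\<And>u. u \<in> verts \<Gamma> \<Longrightarrow> carrier (G u) \<noteq> {\<one>\<^bsub>G u\<^esub>}"
  shows "\<exists>\<phi>.
      (\<forall>g\<in>carrier (graph_product \<Gamma> G). \<forall>u. prec_maximal \<Gamma> u \<longrightarrow>
         \<phi> (translate (graph_product \<Gamma> G) g (base_hyperplane \<Gamma> G u))
           = conjugate_subgroup (graph_product \<Gamma> G) g (vertex_subgroup \<Gamma> G u)) \<and>
      graph_isomorphism \<phi> (maximal_hyperplane_graph \<Gamma> G) (small_crossing_graph \<Gamma> G)"
proof -
  interpret graph_of_groups \<Gamma> G using assms by (rule graph_of_groups.intro)
  \<comment> \<open>The witness for the map is \<open>hyp_conj\<close>; the translate of a base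
    hyperplane is \<open>hyp g u\<close>, whose value is the required conjugate.\<close>
  have "hyp_conj (translate P g (base_hyperplane \<Gamma> G u)) =
      conjugate_subgroup P g (vertex_subgroup \<Gamma> G u)"
    if "g \<in> carrier P" "prec_maximal \<Gamma> u" for g u
    using that
    by (simp add: prec_maximal_def base_hyperplane_hyp translate_hyp hyp_conj_hyp vconj_def)
  then show ?thesis using hyp_conj_isomorphism by blast
qed

end
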